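(* For any strict partition $\lambda$, we have $$P_\lambda(X\,|\,t)=2^{-\ell(\lambda)}\,R^\infty\star\widehat{\mathfrak c}^{\,\lambda}_\lambda,$$ where $\ell(\lambda)$ is the number of nonzero parts of $\lambda$.
   Context: $X=(x_1,x_2,\ldots)$ and $t=(t_1,t_2,\ldots)$ are sequences of independent variables. A partition is strict if its nonzero parts are distinct. Put $(x\,|\,t)^r=(x-t_1)\cdots(x-t_r)$. For a strict partition $\lambda$ of length $\ell$ and $n\geq\ell$, Ivanov's double Schur $P$-function is $$P_\lambda(x_1,\ldots,x_n\,|\,t)=\frac1{(n-\ell)!}\sum_{\varpi\in S_n}\varpi\left(\prod_{i=1}^\ell(x_i\,|\,t)^{\lambda_i}\prod_{i\leq\ell,\ i<j\leq n}\frac{x_i+x_j}{x_i-x_j}\right),$$ where $S_n$ permutes the $x_i$; $P_\lambda(X\,|\,t)$ is the projective limit of $P_\lambda(x_1,\ldots,x_{2m}\,|\,t)$ as $m\to\infty$ (along even numbers of variables). Define $q_r(X)$ by $\prod_{i\geq1}\frac{1+x_is}{1-x_is}=\sum_{r\geq0}q_r(X)s^r$ ($q_r=0$ for $r<0$), let $e^r_j(-t)=e_j(-t_1,\ldots,-t_r)$ for $r\geq0$ (elementary symmetric polynomials), and set $\mathfrak c^r_p=\sum_{j=0}^pq_{p-j}(X)\,e^r_j(-t)$ (zero for $p<0$). For integer sequences $\alpha=(\alpha_1,\ldots,\alpha_\ell)$, $\beta=(\beta_1,\ldots,\beta_\ell)$, set $\widehat{\mathfrak c}^{\,\beta}_\alpha=\widehat{\mathfrak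 c}^{\,\beta_1}_{\alpha_1}\widehat{\mathfrak c}^{\,\beta_2}_{\alpha_2}\cdots\widehat{\mathfrak c}^{\,\beta_\ell}_{\alpha_\ell}$, where the $i$-th factor (which depends on the position $i$) is $$\widehat{\mathfrak c}^{\,\beta_i}_{\alpha_i}=\mathfrak c^{\beta_i}_{\alpha_i}+\begin{cases}(-1)^ie^{\alpha_i}_{\alpha_i}(-t)&\text{if }\beta_i=\alpha_i>0,\\0&\text{otherwise.}\end{cases}$$ For $i<j$ the raising operator $R_{ij}$ acts on integer sequences by $R_{ij}\alpha=(\alpha_1,\ldots,\alpha_i+1,\ldots,\alpha_j-1,\ldots)$. For a monomial $R=\prod_{i<j}R_{ij}^{n_{ij}}$ let $\mathrm{supp}(R)$ be the set of all indices $i$ and $j$ such that $n_{ij}>0$. With $\nu=R\alpha$, define $R\star\widehat{\mathfrak c}^{\,\beta}_\alpha=\overline{\mathfrak c}^{\,\beta_1}_{\nu_1}\cdots\overline{\mathfrak c}^{\,\beta_\ell}_{\nu_\ell}$, where $\overline{\mathfrak c}^{\,\beta_i}_{\nu_i}=\mathfrak c^{\beta_i}_{\nu_i}$ if $i\in\mathrm{supp}(R)$ and $\overline{\mathfrak c}^{\,\beta_i}_{\nu_i}=\widehat{\mathfrak c}^{\,\beta_i}_{\nu_i}$ otherwise. Finally $R^\infty=\prod_{1\leq i<j\leq\ell}\frac{1-R_{ij}}{1+R_{ij}}$ with $\ell=\ell(\lambda)$, expanded as a formal power series in monomials in the $R_{ij}$ (treated as distinct commuting formal symbols), and $R^\infty\star$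 is extended linearly from monomials (only finitely many monomials contribute). In the proposition $\alpha=\beta=\lambda=(\lambda_1,\ldots,\lambda_\ell)$. *)

theory Defs
  imports
    "HOL-Library.Poly_Mapping"
    "HOL-Library.Groups_Big_Fun"
    "HOL-Combinatorics.Permutations"
    "HOL-Computational_Algebra.Fraction_Field"
    "HOL-Computational_Algebra.Formal_Power_Series"
begin

section \<open>Polynomials in x and t, and the projective limit in x\<close>

text \<open>
  Polynomials are finitely supported functions on monomials. All indices of variables start
  at 1; the variable with index 0 is never used. Polynomials in the variables x have coefficients
  in the polynomial ring over the rationals in the variables t.
\<close>

type_synonym tpoly = "(nat \<Rightarrow>\<^sub>0 nat) \<Rightarrow>\<^sub>0 rat"
type_synonym xpoly = "(nat \<Rightarrow>\<^sub>0 nat) \<Rightarrow>\<^sub>0 tpoly"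

definition indet :: "nat \<Rightarrow> (nat \<Rightarrow>\<^sub>0 nat) \<Rightarrow>\<^sub>0 'a::comm_ring_1" where
  "indet i = Poly_Mapping.single (Poly_Mapping.single i 1) 1"

definition const_poly :: "'a::comm_ring_1 \<Rightarrow> (nat \<Rightarrow>\<^sub>0 nat) \<Rightarrow>\<^sub>0 'a" where
  "const_poly c = Poly_Mapping.single 0 c"

text \<open>The substitution x_i = 0 for all i outside 1, ..., n: it keeps exactly the monomials in
  x_1, ..., x_n.\<close>

definition restr :: "nat \<Rightarrow> xpoly \<Rightarrow> xpoly" where
  "restr n p = Poly_Mapping.mapp (\<lambda>k c. c when Poly_Mapping.keys k \<subseteq> {1..n}) p"

lemma lookup_restr:
  "Poly_Mapping.lookup (restr n p) k =
     (Poly_Mapping.lookup p k when Poly_Mapping.keys k \<subseteq> {1..n})"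
  unfolding restr_def lookup_mapp by (auto simp: when_def in_keys_iff)

lemma restr_0 [simp]: "restr n 0 = 0"
  by (rule poly_mapping_eqI) (simp add: lookup_restr)

lemma restr_const_poly [simp]: "restr n (const_poly c) = const_poly c"
  by (rule poly_mapping_eqI) (auto simp: lookup_restr const_poly_def lookup_single when_def)

lemma restr_1 [simp]: "restr n 1 = 1"
  by (rule poly_mapping_eqI) (auto simp: lookup_restr lookup_one when_def)

lemma restr_add: "restr n (p + q) = restr n p + restr n q"
  by (rule poly_mapping_eqI) (simp add: lookup_restr lookup_add when_def)

lemma restr_uminus: "restr n (- p) = - restr n p"
  by (rule poly_mapping_eqI) (simp add: lookup_restr when_def)

lemma restr_diff: "restr n (p - q) = restr n p - restr n q"
  by (rule poly_mapping_eqI) (simp add: lookup_restr lookup_minus when_def)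

lemma restr_sum: "restr n (sum f A) = (\<Sum>a\<in>A. restr n (f a))"
  by (induction A rule: infinite_finite_induct) (auto simp: restr_add)

lemma keys_add_nat:
  fixes a b :: "nat \<Rightarrow>\<^sub>0 nat"
  shows "Poly_Mapping.keys (a + b) = Poly_Mapping.keys a \<union> Poly_Mapping.keys b"
  by (auto simp: in_keys_iff lookup_add)

lemma restr_mult: "restr n (p * q) = restr n p * restr n q"
proof (rule poly_mapping_eqI)
  fix k :: "nat \<Rightarrow>\<^sub>0 nat"
  let ?S = "{1..n}"
  show "Poly_Mapping.lookup (restr n (p * q)) k = Poly_Mapping.lookup (restr n p * restr n q) k"
  proof (cases "Poly_Mapping.keys k \<subseteq> ?S")
    case True
    then have q: "(Poly_Mapping.lookup q b when k = a + b) =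
        (Poly_Mapping.lookup (restr n q) b when k = a + b)" for a b
      by (auto simp: lookup_restr when_def keys_add_nat)
    have p: "Poly_Mapping.lookup p a * Sum_any (\<lambda>b. f b when k = a + b) =
        Poly_Mapping.lookup (restr n p) a * Sum_any (\<lambda>b. f b when k = a + b)"
      for a and f :: "(nat \<Rightarrow>\<^sub>0 nat) \<Rightarrow> tpoly"
    proof (cases "Poly_Mapping.keys a \<subseteq> ?S")
      case False
      with True have "(f b when k = a + b) = 0" for b
        by (auto simp: when_def keys_add_nat)
      then show ?thesis by simp
    qed (simp add: lookup_restr)
    from True have "Poly_Mapping.lookup (restr n (p * q)) k = Poly_Mapping.lookup (p * q) k"
      by (simp add: lookup_restr)
    then show ?thesis
      unfolding lookup_mult by (simp only: p q)
  next
    case False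
    then have *: "Poly_Mapping.lookup (restr n p) a *
        Sum_any (\<lambda>b. Poly_Mapping.lookup (restr n q) b when k = a + b) = 0" for a
    proof (cases "Poly_Mapping.keys a \<subseteq> ?S")
      case True
      with False have "\<not> Poly_Mapping.keys b \<subseteq> ?S" if "k = a + b" for b
        using that by (metis keys_add_nat Un_subset_iff)
      then have "(Poly_Mapping.lookup (restr n q) b when k = a + b) = 0" for b
        unfolding lookup_restr when_def by presburger
      then show ?thesis by simp
    qed (simp add: lookup_restr)
    have "Poly_Mapping.lookup (restr n p * restr n q) k = 0"
      unfolding lookup_mult * by simp
    with False show ?thesis
      by (simp add: lookup_restr[of n "p * q"])
  qed
qed

text \<open>
  The projective limit along even numbers of variables. An element is a family whose m-th member
  is a polynomial in x_1, ..., x_(2m) (the case m = n of the condition) and whose members are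
  compatible with setting the last variables to 0.
\<close>

typedef xlim = "{f :: nat \<Rightarrow> xpoly. \<forall>m n. m \<le> n \<longrightarrow> restr (2 * m) (f n) = f m}"
  morphisms component Abs_xlim
  by (rule exI[of _ "\<lambda>_. 0"]) simp

setup_lifting type_definition_xlim

instantiation xlim :: comm_ring_1
begin

lift_definition zero_xlim :: xlim is "\<lambda>_. 0" by simp
lift_definition one_xlim :: xlim is "\<lambda>_. 1" by simp
lift_definition plus_xlim :: "xlim \<Rightarrow> xlim \<Rightarrow> xlim" is "\<lambda>f g m. f m + g m"
  by (simp add: restr_add)
lift_definition uminus_xlim :: "xlim \<Rightarrow> xlim" is "\<lambda>f m. - f m"
  by (simp add: restr_uminus)
lift_definition minus_xlim :: "xlim \<Rightarrow> xlim \<Rightarrow> xlim" is "\<lambda>f g m. f m - g m"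
  by (simp add: restr_diff)
lift_definition times_xlim :: "xlim \<Rightarrow> xlim \<Rightarrow> xlim" is "\<lambda>f g m. f m * g m"
  by (simp add: restr_mult)

instance
  by standard (transfer; simp add: algebra_simps fun_eq_iff)+

end

definition tconst :: "tpoly \<Rightarrow> xlim" where
  "tconst a = Abs_xlim (\<lambda>m. const_poly a)"

lemma component_tconst [simp]: "component (tconst a) m = const_poly a"
  unfolding tconst_def by (simp add: Abs_xlim_inverse)

definition qconst :: "rat \<Rightarrow> xlim" where
  "qconst a = tconst (const_poly a)"


section \<open>Double Schur P-functions\<close>

text \<open>A strict partition is given by the list of its nonzero parts, so that its length is the
  length of the list and its i-th part is at position i - 1.\<close>

definition strict_partition :: "nat list \<Rightarrow> bool" where
  "strict_partition lam \<longleftrightarrow> sorted_wrt (>) lam \<and> 0 \<notin> set lam"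

definition part :: "nat list \<Rightarrow> nat \<Rightarrow> nat" where
  "part lam i = lam ! (i - 1)"

definition double_power :: "'a::comm_ring_1 \<Rightarrow> (nat \<Rightarrow> 'a) \<Rightarrow> nat \<Rightarrow> 'a" where
  "double_power y a r = (\<Prod>k=1..r. y - a k)"

abbreviation to_fract :: "'a::idom \<Rightarrow> 'a fract" where
  "to_fract p \<equiv> Fraction_Field.Fract p 1"

definition xfrac :: "nat \<Rightarrow> xpoly fract" where
  "xfrac i = to_fract (indet i)"

definition tfrac :: "nat \<Rightarrow> xpoly fract" where
  "tfrac k = to_fract (const_poly (indet k))"

text \<open>Ivanov's formula for the variables x_1, ..., x_n, as a rational function
  (meaningful for \<open>length lam \<le> n\<close>).\<close>

definition double_schur_P_fin :: "nat list \<Rightarrow> nat \<Rightarrow> xpoly fract" where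
  "double_schur_P_fin lam n =
     1 / of_nat (fact (n - length lam)) *
     (\<Sum>w | w permutes {1..n}.
        (\<Prod>i=1..length lam. double_power (xfrac (w i)) tfrac (part lam i)) *
        (\<Prod>(i, j) \<in> {(i, j). 1 \<le> i \<and> i \<le> length lam \<and> i < j \<and> j \<le> n}.
           (xfrac (w i) + xfrac (w j)) / (xfrac (w i) - xfrac (w j))))"

text \<open>
  The element of the projective limit whose component in 2m variables is Ivanov's polynomial,
  whenever the latter is defined. Compatibility determines the remaining components, so there is
  at most one such element.
\<close>

definition double_schur_P :: "nat list \<Rightarrow> xlim" where
  "double_schur_P lam =
     (THE F. \<forall>m. length lam \<le> 2 * m \<longrightarrow>
        to_fract (component F m) = double_schur_P_fin lam (2 * m))"


section \<open>The series q and the factors c\<close>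

unbundle fps_syntax

definition geometric :: "'a::comm_ring_1 \<Rightarrow> 'a fps" where
  "geometric a = Abs_fps (\<lambda>k. a ^ k)"

lemma geometric_inverse: "(1 - fps_const a * fps_X) * geometric a = 1"
proof (rule fps_ext)
  fix n
  show "((1 - fps_const a * fps_X) * geometric a) $ n = 1 $ n"
    by (cases n) (simp_all add: geometric_def left_diff_distrib mult.assoc)
qed

definition q_series :: "nat \<Rightarrow> xpoly fps" where
  "q_series n = (\<Prod>i=1..n. (1 + fps_const (indet i) * fps_X) * geometric (indet i))"

definition restr_fps :: "nat \<Rightarrow> xpoly fps \<Rightarrow> xpoly fps" where
  "restr_fps n f = Abs_fps (\<lambda>r. restr n (f $ r))"

lemma restr_fps_mult: "restr_fps n (f * g) = restr_fps n f * restr_fps n g"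
  by (rule fps_ext) (simp add: restr_fps_def fps_mult_nth restr_sum restr_mult)

lemma restr_fps_1: "restr_fps n 1 = 1"
  by (rule fps_ext) (simp add: restr_fps_def)

lemma restr_indet: "restr n (indet i) = (if i \<in> {1..n} then indet i else 0)"
  by (rule poly_mapping_eqI)
    (auto simp: lookup_restr indet_def lookup_single when_def split: if_splits)

lemma restr_power: "restr n (p ^ k) = restr n p ^ k"
  by (induction k) (auto simp: restr_mult)

lemma restr_fps_factor:
  "restr_fps n ((1 + fps_const (indet i) * fps_X) * geometric (indet i)) =
     (if i \<in> {1..n} then (1 + fps_const (indet i) * fps_X) * geometric (indet i) else 1)"
proof -
  have "restr_fps n (1 + fps_const (indet i) * fps_X) =
      1 + fps_const (restr n (indet i)) * fps_X"
    by (rule fps_ext) (auto simp: restr_fps_def restr_add fps_X_def)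
  moreover have "restr_fps n (geometric (indet i)) = geometric (restr n (indet i))"
    by (rule fps_ext) (simp add: restr_fps_def geometric_def restr_power)
  moreover have "geometric (0::xpoly) = 1"
    by (rule fps_ext) (simp add: geometric_def)
  ultimately show ?thesis
    by (simp add: restr_fps_mult restr_indet)
qed

lemma restr_q_series:
  assumes "m \<le> n"
  shows "restr m (q_series n $ r) = q_series m $ r"
proof -
  let ?g = "\<lambda>i. (1 + fps_const (indet i :: xpoly) * fps_X) * geometric (indet i)"
  have "restr_fps m (prod ?g A) = (\<Prod>i\<in>A. restr_fps m (?g i))" for A :: "nat set"
    by (induction A rule: infinite_finite_induct) (auto simp: restr_fps_mult restr_fps_1)
  then have "restr_fps m (q_series n) = (\<Prod>i=1..n. if i \<in> {1..m} then ?g i else 1)"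
    unfolding q_series_def by (simp only: restr_fps_factor)
  also have "\<dots> = q_series m"
    unfolding q_series_def using assms by (intro prod.mono_neutral_cong_right) auto
  finally have "restr_fps m (q_series n) $ r = q_series m $ r"
    by (simp only:)
  then show ?thesis
    unfolding restr_fps_def fps_nth_Abs_fps .
qed

lift_definition q_fun :: "nat \<Rightarrow> xlim" is "\<lambda>r m. q_series (2 * m) $ r"
  by (simp add: restr_q_series)

definition elem_sym :: "nat \<Rightarrow> nat \<Rightarrow> (nat \<Rightarrow> 'a::comm_ring_1) \<Rightarrow> 'a" where
  "elem_sym r j a = (\<Sum>S | S \<subseteq> {1..r} \<and> card S = j. \<Prod>i\<in>S. a i)"

definition e_neg_t :: "nat \<Rightarrow> nat \<Rightarrow> xlim" where
  "e_neg_t r j = tconst (elem_sym r j (\<lambda>i. - indet i))"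

definition c_fun :: "nat \<Rightarrow> int \<Rightarrow> xlim" where
  "c_fun r p = (if p < 0 then 0 else \<Sum>j=0..nat p. q_fun (nat p - j) * e_neg_t r j)"

text \<open>The factor in position i.\<close>

definition c_hat :: "nat \<Rightarrow> nat \<Rightarrow> int \<Rightarrow> xlim" where
  "c_hat i b a = c_fun b a + (if int b = a \<and> a > 0 then (- 1) ^ i * e_neg_t (nat a) (nat a) else 0)"


section \<open>Raising operators\<close>

text \<open>
  A monomial in the raising operators is its exponent function. Sequences are
  functions, of which only the values at 1, ..., l matter, and superscripts are natural numbers.
\<close>

type_synonym raising_monom = "(nat \<times> nat) \<Rightarrow>\<^sub>0 nat"

definition raise_seq :: "raising_monom \<Rightarrow> (nat \<Rightarrow> int) \<Rightarrow> nat \<Rightarrow> int" where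
  "raise_seq R al k = al k +
     (\<Sum>(i, j)\<in>Poly_Mapping.keys R.
        int (Poly_Mapping.lookup R (i, j)) * (of_bool (k = i) - of_bool (k = j)))"

lemma raise_seq_single:
  "i \<noteq> j \<Longrightarrow> raise_seq (Poly_Mapping.single (i, j) 1) al = al(i := al i + 1, j := al j - 1)"
  by (auto simp: raise_seq_def fun_eq_iff)

lemma raise_seq_0: "raise_seq 0 al = al"
  by (simp add: raise_seq_def fun_eq_iff)

lemma raise_seq_add: "raise_seq (R + S) al = raise_seq R (raise_seq S al)"
proof
  fix k
  let ?f = "\<lambda>(i :: nat, j :: nat) m. int m * (of_bool (k = i) - of_bool (k = j))"
  have "(\<Sum>x\<in>Poly_Mapping.keys (R + S). ?f x (Poly_Mapping.lookup (R + S) x)) =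
      (\<Sum>x\<in>Poly_Mapping.keys R. ?f x (Poly_Mapping.lookup R x)) +
      (\<Sum>x\<in>Poly_Mapping.keys S. ?f x (Poly_Mapping.lookup S x))"
    by (rule setsum_keys_plus_distrib) (auto simp: algebra_simps)
  then show "raise_seq (R + S) al k = raise_seq R (raise_seq S al) k"
    by (simp add: raise_seq_def case_prod_unfold)
qed

definition supp :: "raising_monom \<Rightarrow> nat set" where
  "supp R = (\<Union>(i, j)\<in>Poly_Mapping.keys R. {i, j})"

definition star_monom ::
  "nat \<Rightarrow> (nat \<Rightarrow> nat) \<Rightarrow> (nat \<Rightarrow> int) \<Rightarrow> raising_monom \<Rightarrow> xlim" where
  "star_monom l be al R =
     (\<Prod>i=1..l. if i \<in> supp R then c_fun (be i) (raise_seq R al i)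
                else c_hat i (be i) (raise_seq R al i))"

definition pairs :: "nat \<Rightarrow> (nat \<times> nat) set" where
  "pairs l = {(i, j). 1 \<le> i \<and> i < j \<and> j \<le> l}"

text \<open>
  The coefficients of the product of the series (1 - R_ij) / (1 + R_ij). As these are series in
  distinct commuting symbols, a coefficient of the product is a product of coefficients.
\<close>

definition R_infty :: "nat \<Rightarrow> raising_monom \<Rightarrow> rat" where
  "R_infty l R =
     (if Poly_Mapping.keys R \<subseteq> pairs l
      then \<Prod>ij\<in>pairs l. ((1 - fps_X) / (1 + fps_X)) $ Poly_Mapping.lookup R ij
      else 0)"

text \<open>Linear extension to formal power series; \<^const>\<open>Sum_any\<close> is the sum over the nonzero terms.\<close>

definition star ::
  "(raising_monom \<Rightarrow> rat) \<Rightarrow> nat \<Rightarrow> (nat \<Rightarrow> nat) \<Rightarrow> (nat \<Rightarrow> int) \<Rightarrow> xlim" where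
  "star C l be al = Sum_any (\<lambda>R. qconst (C R) * star_monom l be al R)"

lemma qconst_0 [simp]: "qconst 0 = 0"
  by (simp add: qconst_def tconst_def const_poly_def zero_xlim_def)

lemma star_monom_eq_0:
  assumes "i \<in> supp R" "i \<in> {1..l}" "raise_seq R al i < 0"
  shows "star_monom l be al R = 0"
  unfolding star_monom_def using assms by (auto simp: c_fun_def intro!: prod_zero)

lemma raise_seq_not_supp: "i \<notin> supp R \<Longrightarrow> raise_seq R al i = al i"
  unfolding raise_seq_def supp_def by (auto intro!: sum.neutral)

lemma finite_bounded_monoms:
  assumes "finite A"
  shows "finite {R :: 'a \<Rightarrow>\<^sub>0 nat. Poly_Mapping.keys R \<subseteq> A \<and>
    (\<forall>x. Poly_Mapping.lookup R x \<le> N)}"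
    (is "finite ?M")
proof (rule finite_imageD)
  have "Poly_Mapping.lookup ` ?M \<subseteq> {f. \<forall>x. (x \<in> A \<longrightarrow> f x \<in> {..N}) \<and> (x \<notin> A \<longrightarrow> f x = 0)}"
    by (auto simp: in_keys_iff)
  then show "finite (Poly_Mapping.lookup ` ?M)"
    by (rule finite_subset) (intro finite_set_of_finite_funs assms finite_atMost)
  show "inj_on Poly_Mapping.lookup ?M"
    by (rule inj_onI) (simp only: lookup_inject)
qed

lemma finite_star_terms:
  "finite {R. qconst (R_infty l R) * star_monom l be al R \<noteq> 0}"
proof -
  define A where "A = (\<Sum>i=1..l. \<bar>al i\<bar>)"
  have bound: "Poly_Mapping.lookup R (i, j) \<le> nat (2 * A)"
    if nz: "qconst (R_infty l R) * star_monom l be al R \<noteq> 0" for R i j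
  proof (cases "(i, j) \<in> Poly_Mapping.keys R")
    case True
    have keys: "Poly_Mapping.keys R \<subseteq> pairs l"
      using nz by (auto simp: R_infty_def split: if_splits)
    have ij: "1 \<le> i" "i < j" "j \<le> l"
      using True keys by (auto simp: pairs_def)
    have low: "- \<bar>al k\<bar> \<le> raise_seq R al k" if "k \<in> {1..l}" for k
      using star_monom_eq_0[of k R l al be] raise_seq_not_supp[of k R al] nz that
      by (cases "k \<in> supp R") force+
    let ?L = "\<lambda>x. int (Poly_Mapping.lookup R x)"
    let ?d = "\<lambda>x. of_bool (fst x \<in> {j..l}) - of_bool (snd x \<in> {j..l}) :: int"
    have "- A \<le> - (\<Sum>k=j..l. \<bar>al k\<bar>)"
      unfolding A_def using ij by (simp, intro sum_mono2) auto
    also have "\<dots> \<le> (\<Sum>k=j..l. raise_seq R al k)"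
      unfolding sum_negf[symmetric] using ij low by (intro sum_mono) auto
    also have "\<dots> = (\<Sum>k=j..l. al k) + (\<Sum>x\<in>Poly_Mapping.keys R. \<Sum>k=j..l.
        ?L x * (of_bool (k = fst x) - of_bool (k = snd x)))"
      unfolding raise_seq_def sum.distrib
      by (subst sum.swap) (simp add: case_prod_unfold)
    also have "\<dots> = (\<Sum>k=j..l. al k) + (\<Sum>x\<in>Poly_Mapping.keys R. ?L x * ?d x)"
      by (simp add: sum_distrib_left[symmetric] sum_subtractf of_bool_def)
    also have "(\<Sum>k=j..l. al k) \<le> (\<Sum>k=j..l. \<bar>al k\<bar>)"
      by (intro sum_mono) auto
    also have "(\<Sum>k=j..l. \<bar>al k\<bar>) \<le> A"
      unfolding A_def using ij by (intro sum_mono2) auto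
    also have "(\<Sum>x\<in>Poly_Mapping.keys R. ?L x * ?d x) \<le> (\<Sum>x\<in>{(i, j)}. ?L x * ?d x)"
    proof -
      have "(\<Sum>x\<in>Poly_Mapping.keys R - {(i, j)}. ?L x * ?d x) \<le> 0"
        using keys by (intro sum_nonpos mult_nonneg_nonpos) (auto simp: pairs_def)
      then show ?thesis
        using True by (subst sum.remove[of _ "(i, j)"]) auto
    qed
    also have "(\<Sum>x\<in>{(i, j)}. ?L x * ?d x) = - ?L (i, j)"
      using ij by simp
    finally show ?thesis by simp
  qed (simp add: in_keys_iff)
  have "finite (pairs l)"
    by (rule finite_subset[of _ "{1..l} \<times> {1..l}"]) (auto simp: pairs_def)
  then show ?thesis
    by (rule finite_subset[OF _ finite_bounded_monoms[where N = "nat (2 * A)"], rotated])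
      (use bound in \<open>auto simp: R_infty_def split: if_splits\<close>)
qed

end

theory Submission
  imports Defs
begin

text \<open>
  Fix an even number n of variables, let l be the length of \<open>\<lambda>\<close>, and put
  \<open>w_k = \<Prod>j \<noteq> k. (x_k + x_j) / (x_k - x_j)\<close>. In Ivanov's formula the summand depends
  only on the images of 1, ..., l under the permutation, so the factor 1/(n - l)! turns the sum
  into one over injective l-tuples f of indices. Completing the product over pairs to the weights \<open>w_(f i)\<close> leaves the factors
  \<open>(x_(f j) - x_(f i)) / (x_(f j) + x_(f i))\<close> for \<open>i < j\<close>, which vanish when f is not injective.
  Hence \<open>P_\<lambda>\<close> is a sum over all tuples (\<open>ivanov_sum_eq_tuple_sum\<close>), and the factor of a pair is
  formally \<open>(1 - R_ij) / (1 + R_ij)\<close> with \<open>R_ij = x_(f i) / x_(f j)\<close>.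

  This formal expansion becomes an identity when the sum over the last entry of the tuple is
  carried out first. The partial fraction expansion of a q-series,
  \<open>(\<Prod>j\<in>A. (1 + x_j s) / (1 - x_j s)) = (-1)^|A| + (\<Sum>k\<in>A. 2 w_k / (1 - x_k s))\<close>, applied to the
  complement A of the l - 1 entries already chosen, evaluates that sum: up to the constant term,
  it is a coefficient of the q-series in all n variables, multiplied by
  \<open>(1 - x_i s) / (1 + x_i s)\<close> for the chosen indices i. Expanding these factors produces the
  powers of the operators \<open>R_il\<close>. Since n is even, subtracting the constant term contributes the
  sign \<open>(-1)^l\<close>, and this is precisely the correction that distinguishes the hatted factor in
  position l. The result is a recursion in l for sums over tuples (\<open>tuple_sum_Suc\<close>).

  The raising operator expression satisfies the same recursion (\<open>box_star_Suc\<close>). A monomial in the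
  operators splits into a part R in the first l - 1 positions and a part M in the operators
  \<open>R_il\<close>. The only subtle point is a position that occurs in M and not in R: its factor carries no
  hat. But M has raised its subscript strictly above its superscript, where the hatted and the
  unhatted factor coincide. For the induction the subscripts therefore have to be allowed to
  exceed the superscripts (\<open>box_star_eq_tuple_sum\<close>).
\<close>

section \<open>Partial fractions of the q-series\<close>

text \<open>
  The series of (1 - a s) / (1 + a s) in s. For a = 1 its coefficients are those of the
  expansion of (1 - R) / (1 + R).
\<close>

definition ratio_series :: "'a::comm_ring_1 \<Rightarrow> 'a fps" where
  "ratio_series a = (1 - fps_const a * fps_X) * geometric (- a)"

definition q_gen :: "(nat \<Rightarrow> 'a::comm_ring_1) \<Rightarrow> nat set \<Rightarrow> 'a fps" where
  "q_gen x A = (\<Prod>i\<in>A. (1 + fps_const (x i) * fps_X) * geometric (x i))"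

text \<open>
  Half the coefficient of 1 / (1 - x_k s) in the partial fraction expansion of \<open>q_gen x A\<close>.
\<close>

definition pole_weight :: "(nat \<Rightarrow> 'a::field) \<Rightarrow> nat set \<Rightarrow> nat \<Rightarrow> 'a" where
  "pole_weight x A k = (\<Prod>j\<in>A - {k}. (x k + x j) / (x k - x j))"

lemma pole_weight_insert:
  assumes "finite A" "z \<notin> A" "k \<in> A"
  shows "pole_weight x (insert z A) k = (x k + x z) / (x k - x z) * pole_weight x A k"
proof -
  have "insert z A - {k} = insert z (A - {k})" using assms by auto
  then show ?thesis using assms by (simp add: pole_weight_def)
qed

text \<open>
  The partial fraction expansion of the q-series at the point s = 1/y, cleared of the inverse so
  that it needs no separate treatment of y = 0. The induction adds a variable z; its weight is
  given by the induction hypothesis at y = x z, and what remains is the two-pole identity \<open>step\<close>.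
\<close>

lemma partial_fractions_at:
  fixes x :: "nat \<Rightarrow> 'a::field"
  assumes "finite A" "inj_on x A" "y \<notin> x ` A"
  shows "(\<Prod>j\<in>A. (y + x j) / (y - x j)) =
    (- 1) ^ card A + (\<Sum>k\<in>A. 2 * pole_weight x A k * (y / (y - x k)))"
  using assms
proof (induction A arbitrary: y rule: finite_induct)
  case empty
  then show ?case by simp
next
  case (insert z A)
  have yz: "y \<noteq> x z" and yA: "y \<notin> x ` A" and zA: "x z \<notin> x ` A" and inj: "inj_on x A"
    using insert.prems insert.hyps by (auto simp: inj_on_def)
  have rz: "pole_weight x (insert z A) z = (-1) ^ card A + (\<Sum>k\<in>A. 2 * pole_weight x A k * (x z / (x z - x k)))"
    using insert.IH[OF inj zA] insert.hyps by (simp add: pole_weight_def)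
  \<comment> \<open>The product of two simple fractions is a combination of the same two fractions.\<close>
  have step: "(y + x z) / (y - x z) * (y / (y - x k)) =
      2 * (x z / (x z - x k)) * (y / (y - x z)) + (x k + x z) / (x k - x z) * (y / (y - x k))"
    if "k \<in> A" for k
  proof -
    have "y - x k \<noteq> 0" "y - x z \<noteq> 0" "x z - x k \<noteq> 0" "x k - x z \<noteq> 0"
      using that yz yA zA by (auto simp: image_iff)
    then show ?thesis
      by (simp add: divide_simps) (simp add: algebra_simps)
  qed
  have const: "(y + x z) / (y - x z) = - 1 + 2 * (y / (y - x z))"
    using yz by (simp add: field_simps)
  have "(\<Prod>j\<in>insert z A. (y + x j) / (y - x j)) = (y + x z) / (y - x z) *
      ((- 1) ^ card A + (\<Sum>k\<in>A. 2 * pole_weight x A k * (y / (y - x k))))"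
    using insert.hyps insert.IH[OF inj yA] by simp
  also have "\<dots> = (y + x z) / (y - x z) * (- 1) ^ card A +
      (\<Sum>k\<in>A. 2 * pole_weight x A k * ((y + x z) / (y - x z) * (y / (y - x k))))"
    unfolding distrib_left sum_distrib_left
    by (intro arg_cong2[where f = "(+)"] sum.cong refl) (simp only: mult_ac)
  also have "(\<Sum>k\<in>A. 2 * pole_weight x A k * ((y + x z) / (y - x z) * (y / (y - x k)))) =
     (\<Sum>k\<in>A. 2 * pole_weight x A k * (2 * (x z / (x z - x k)) * (y / (y - x z)) + (x k + x z) / (x k - x z) * (y / (y - x k))))"
    by (intro sum.cong refl) (simp only: step)
  also have "\<dots> = 2 * (y / (y - x z)) * (\<Sum>k\<in>A. 2 * pole_weight x A k * (x z / (x z - x k))) +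
     (\<Sum>k\<in>A. 2 * pole_weight x (insert z A) k * (y / (y - x k)))"
    unfolding sum_distrib_left sum.distrib[symmetric]
    by (intro sum.cong refl)
      (simp only: pole_weight_insert[OF insert.hyps] distrib_left mult_ac)
  also have "(\<Sum>k\<in>A. 2 * pole_weight x A k * (x z / (x z - x k))) = pole_weight x (insert z A) z - (-1) ^ card A"
    using rz by simp
  also have "(y + x z) / (y - x z) * (- 1) ^ card A + (2 * (y / (y - x z)) * (pole_weight x (insert z A) z - (-1) ^ card A) +
     (\<Sum>k\<in>A. 2 * pole_weight x (insert z A) k * (y / (y - x k)))) =
     (- 1) ^ card (insert z A) + (\<Sum>k\<in>insert z A. 2 * pole_weight x (insert z A) k * (y / (y - x k)))"
    using insert.hyps by (simp only: const) (simp add: algebra_simps)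
  finally show ?case .
qed

text \<open>
  Both sides are (1 + z s) / (1 - z s).
\<close>

lemma factor_geometric:
  "(1 + fps_const z * fps_X) * geometric z = - 1 + 2 * geometric (z::'a::comm_ring_1)"
  using geometric_inverse[of z] by (simp add: algebra_simps)

lemma one_minus_X_nonzero: "1 - fps_const (z::'a::field) * fps_X \<noteq> 0"
proof
  assume "1 - fps_const z * fps_X = 0"
  then have "(1 - fps_const z * fps_X) $ 0 = 0" by simp
  then show False by simp
qed

lemma factor_geometric_geometric:
  fixes z y :: "'a::field"
  assumes "y \<noteq> z"
  shows "(1 + fps_const z * fps_X) * geometric z * geometric y =
    fps_const ((y + z) / (y - z)) * geometric y + fps_const (2 * (z / (z - y))) * geometric z"
proof -
  let ?y = "1 - fps_const y * fps_X" and ?z = "1 - fps_const z * fps_X"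
  \<comment> \<open>The coefficients of the two poles, found by evaluating at s = 1/y and s = 1/z.\<close>
  define a where "a = (y + z) / (y - z)"
  define b where "b = 2 * (z / (z - y))"
  have ab: "a + b = 1" "a * z + b * y = - z"
    using assms unfolding a_def b_def
    by (simp_all add: divide_simps right_minus_eq) (simp_all add: algebra_simps)
  have "?y * ?z * ((1 + fps_const z * fps_X) * geometric z * geometric y) =
     (1 + fps_const z * fps_X) * (?z * geometric z) * (?y * geometric y)"
    by (simp only: mult_ac)
  also have "\<dots> = 1 + fps_const z * fps_X"
    by (simp add: geometric_inverse)
  also have "\<dots> = fps_const (a + b) - fps_const (a * z + b * y) * fps_X"
    by (simp only: ab) (simp add: fps_const_neg[symmetric] del: fps_const_neg)
  also have "\<dots> = fps_const a * ?z + fps_const b * ?y"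
    by (simp add: algebra_simps fps_const_add[symmetric] fps_const_mult[symmetric]
        del: fps_const_add fps_const_mult)
  also have "\<dots> = fps_const a * ?z * (?y * geometric y) + fps_const b * ?y * (?z * geometric z)"
    by (simp add: geometric_inverse)
  also have "\<dots> = ?y * ?z * (fps_const a * geometric y + fps_const b * geometric z)"
    by (simp add: algebra_simps)
  finally show ?thesis
    unfolding a_def[symmetric] b_def[symmetric]
    using one_minus_X_nonzero mult_left_cancel no_zero_divisors by metis
qed

text \<open>
  The same expansion for formal power series. A geometric factor that is added to the product
  contributes to each existing pole and to its own; the total at its own pole is a value of the
  product at that pole, which \<open>partial_fractions_at\<close> supplies.
\<close>

lemma partial_fractions_series:
  fixes x :: "nat \<Rightarrow> 'a::field"
  assumes "finite A" "inj_on x A"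
  shows "q_gen x A =
    fps_const ((- 1) ^ card A) + (\<Sum>k\<in>A. fps_const (2 * pole_weight x A k) * geometric (x k))"
  using assms
proof (induction A rule: finite_induct)
  case empty
  then show ?case by (simp add: q_gen_def)
next
  case (insert z A)
  have zA: "x z \<notin> x ` A" and inj: "inj_on x A"
    using insert.prems insert.hyps by (auto simp: inj_on_def)
  define F where "F = (1 + fps_const (x z) * fps_X) * geometric (x z)"
  define e where "e = (- 1 :: 'a) ^ card A"
  have rz: "pole_weight x (insert z A) z = e + (\<Sum>k\<in>A. 2 * pole_weight x A k * (x z / (x z - x k)))"
    using partial_fractions_at[OF insert.hyps(1) inj zA] insert.hyps by (simp add: pole_weight_def e_def)
  have "q_gen x (insert z A) = F * fps_const e +
      (\<Sum>k\<in>A. fps_const (2 * pole_weight x A k) * (F * geometric (x k)))"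
    using insert.hyps insert.IH[OF inj]
    by (simp add: q_gen_def F_def e_def distrib_left sum_distrib_left mult_ac)
  also have "F * fps_const e = - fps_const e + fps_const (2 * e) * geometric (x z)"
    unfolding F_def factor_geometric
    by (simp add: algebra_simps fps_const_mult[symmetric] numeral_fps_const del: fps_const_mult)
  also have "(\<Sum>k\<in>A. fps_const (2 * pole_weight x A k) * (F * geometric (x k))) =
    (\<Sum>k\<in>A. fps_const (2 * pole_weight x A k) * (fps_const ((x k + x z) / (x k - x z)) * geometric (x k)
       + fps_const (2 * (x z / (x z - x k))) * geometric (x z)))"
  proof (intro sum.cong refl)
    fix k assume "k \<in> A"
    then have "x k \<noteq> x z" using zA by (metis imageI)
    from factor_geometric_geometric[OF this]
    show "fps_const (2 * pole_weight x A k) * (F * geometric (x k)) =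
      fps_const (2 * pole_weight x A k) * (fps_const ((x k + x z) / (x k - x z)) * geometric (x k)
       + fps_const (2 * (x z / (x z - x k))) * geometric (x z))"
      unfolding F_def by (simp only:)
  qed
  also have "\<dots> = (\<Sum>k\<in>A. fps_const (2 * pole_weight x (insert z A) k) * geometric (x k)) +
      (\<Sum>k\<in>A. fps_const (2 * (2 * pole_weight x A k * (x z / (x z - x k))))) * geometric (x z)"
    unfolding sum_distrib_right sum.distrib[symmetric]
  proof (intro sum.cong refl)
    fix k assume k: "k \<in> A"
    have distr: "fps_const c * (fps_const a * G + fps_const b * H) =
        fps_const (c * a) * G + fps_const (c * b) * H" for a b c :: 'a and G H
      by (simp add: distrib_left flip: mult.assoc)
    show "fps_const (2 * pole_weight x A k) * (fps_const ((x k + x z) / (x k - x z)) * geometric (x k)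
       + fps_const (2 * (x z / (x z - x k))) * geometric (x z)) =
       fps_const (2 * pole_weight x (insert z A) k) * geometric (x k) +
       fps_const (2 * (2 * pole_weight x A k * (x z / (x z - x k)))) * geometric (x z)"
      unfolding distr pole_weight_insert[OF insert.hyps k] by (simp only: mult_ac)
  qed
  also have "(\<Sum>k\<in>A. fps_const (2 * (2 * pole_weight x A k * (x z / (x z - x k))))) =
      fps_const (2 * (pole_weight x (insert z A) z - e))"
  proof -
    have "fps_const (sum g B) = (\<Sum>k\<in>B. fps_const (g k))" for g :: "nat \<Rightarrow> 'a" and B
      by (induction B rule: infinite_finite_induct) (simp_all flip: fps_const_add)
    then show ?thesis by (simp add: rz sum_distrib_left)
  qed
  also have "- fps_const e + fps_const (2 * e) * geometric (x z) +
     ((\<Sum>k\<in>A. fps_const (2 * pole_weight x (insert z A) k) * geometric (x k)) +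
      fps_const (2 * (pole_weight x (insert z A) z - e)) * geometric (x z)) =
      fps_const ((- 1) ^ card (insert z A)) + (\<Sum>k\<in>insert z A. fps_const (2 * pole_weight x (insert z A) k) * geometric (x k))"
    using insert.hyps unfolding right_diff_distrib fps_const_sub[symmetric]
    by (simp add: e_def algebra_simps del: fps_const_sub)
  finally show ?case .
qed

section \<open>Coefficients of products of series\<close>

text \<open>
  Sums over all monomials in the operators are cut off at exponent N in every symbol. Unlike the
  support of a particular summand, such a box is a product set, and therefore splits along any
  partition of the symbols.
\<close>

definition monoms_in_box :: "'a set \<Rightarrow> nat \<Rightarrow> ('a \<Rightarrow>\<^sub>0 nat) set" where
  "monoms_in_box A N = {R. Poly_Mapping.keys R \<subseteq> A \<and> (\<forall>x. Poly_Mapping.lookup R x \<le> N)}"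

lemma lookup_outside_box:
  "R \<in> monoms_in_box A N \<Longrightarrow> x \<notin> A \<Longrightarrow> Poly_Mapping.lookup R x = 0"
  by (auto simp: monoms_in_box_def in_keys_iff)

lemma sum_monoms_in_box_disjoint_Un:
  fixes g :: "('a \<Rightarrow>\<^sub>0 nat) \<Rightarrow> 'b::comm_monoid_add"
  assumes "A \<inter> B = {}"
  shows "sum g (monoms_in_box (A \<union> B) N) =
    (\<Sum>M\<in>monoms_in_box B N. \<Sum>R\<in>monoms_in_box A N. g (R + M))"
proof -
  \<comment> \<open>The part of a monomial in the symbols from C.\<close>
  define cut where "cut C R = Poly_Mapping.mapp (\<lambda>k c. c when k \<in> C) R"
    for C and R :: "'a \<Rightarrow>\<^sub>0 nat"
  have lookup_cut: "Poly_Mapping.lookup (cut C R) k = (Poly_Mapping.lookup R k when k \<in> C)" for C R k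
    by (auto simp: cut_def lookup_mapp when_def in_keys_iff)
  have "(\<Sum>M\<in>monoms_in_box B N. \<Sum>R\<in>monoms_in_box A N. g (R + M)) =
      (\<Sum>(M, R)\<in>monoms_in_box B N \<times> monoms_in_box A N. g (R + M))"
    by (rule sum.cartesian_product)
  also have "\<dots> = sum g (monoms_in_box (A \<union> B) N)"
  proof (rule sum.reindex_bij_witness[where i = "\<lambda>R. (cut B R, cut A R)" and j = "\<lambda>(M, R). R + M"])
    fix p assume "p \<in> monoms_in_box B N \<times> monoms_in_box A N"
    then obtain M R where p: "p = (M, R)" and M: "M \<in> monoms_in_box B N" and R: "R \<in> monoms_in_box A N"
      by auto
    have out: "Poly_Mapping.lookup M k = 0" if "k \<notin> B" for k
      using lookup_outside_box[OF M] that by auto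
    have out': "Poly_Mapping.lookup R k = 0" if "k \<notin> A" for k
      using lookup_outside_box[OF R] that by auto
    have "cut B (R + M) = M"
      by (rule poly_mapping_eqI, unfold lookup_cut lookup_add) (use out out' assms in \<open>auto simp: when_def\<close>)
    moreover have "cut A (R + M) = R"
      by (rule poly_mapping_eqI, unfold lookup_cut lookup_add) (use out out' assms in \<open>auto simp: when_def\<close>)
    ultimately show "(\<lambda>R. (cut B R, cut A R)) ((\<lambda>(M, R). R + M) p) = p"
      using p by simp
    have "Poly_Mapping.lookup (R + M) k \<le> N" for k
      using M R out[of k] out'[of k] assms
      by (cases "k \<in> A"; cases "k \<in> B") (auto simp: monoms_in_box_def lookup_add)
    then show "(\<lambda>(M, R). R + M) p \<in> monoms_in_box (A \<union> B) N"
      using M R p Poly_Mapping.keys_add[of R M] by (auto simp: monoms_in_box_def)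
  next
    fix R assume R: "R \<in> monoms_in_box (A \<union> B) N"
    have "Poly_Mapping.lookup R k = 0" if "k \<notin> A" "k \<notin> B" for k
      using lookup_outside_box[OF R] that by auto
    then show "(\<lambda>(M, R). R + M) (cut B R, cut A R) = R"
      using assms by (auto intro!: poly_mapping_eqI simp: lookup_cut lookup_add when_def)
    show "(cut B R, cut A R) \<in> monoms_in_box B N \<times> monoms_in_box A N"
      using R by (auto simp: monoms_in_box_def in_keys_iff lookup_cut when_def split: if_splits)
  qed auto
  finally show ?thesis ..
qed

lemma monoms_in_box_empty [simp]: "monoms_in_box {} N = {0}"
  by (auto simp: monoms_in_box_def)

lemma sum_monoms_in_box_single:
  fixes g :: "('a \<Rightarrow>\<^sub>0 nat) \<Rightarrow> 'b::comm_monoid_add"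
  shows "sum g (monoms_in_box {a} N) = (\<Sum>k\<le>N. g (Poly_Mapping.single a k))"
proof (rule sum.reindex_bij_witness[where i = "Poly_Mapping.single a"
      and j = "\<lambda>R. Poly_Mapping.lookup R a"])
  fix R assume R: "R \<in> monoms_in_box {a} N"
  show "Poly_Mapping.single a (Poly_Mapping.lookup R a) = R"
    using lookup_outside_box[OF R]
    by (auto intro!: poly_mapping_eqI simp: lookup_single when_def)
  then show "g (Poly_Mapping.single a (Poly_Mapping.lookup R a)) = g R" by simp
  show "Poly_Mapping.lookup R a \<in> {..N}"
    using R by (simp add: monoms_in_box_def)
qed (auto simp: monoms_in_box_def lookup_single when_def)

text \<open>
  Coefficients with the convention that those at negative positions vanish, matching the
  convention for the factors c.
\<close>

definition nth_int :: "'a::zero fps \<Rightarrow> int \<Rightarrow> 'a" where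
  "nth_int F p = (if p < 0 then 0 else F $ nat p)"

lemma nth_int_mult:
  fixes F G :: "'a::comm_ring_1 fps"
  assumes "p \<le> int N"
  shows "nth_int (F * G) p = (\<Sum>k\<le>N. G $ k * nth_int F (p - int k))"
proof (cases "p < 0")
  case True
  then show ?thesis by (auto simp: nth_int_def)
next
  case False
  have "nth_int (F * G) p = (\<Sum>k=0..nat p. G $ k * F $ (nat p - k))"
    using False by (simp add: nth_int_def mult.commute[of F] fps_mult_nth)
  also have "\<dots> = (\<Sum>k\<in>{0..nat p}. G $ k * nth_int F (p - int k))"
    using False by (intro sum.cong) (auto simp: nth_int_def nat_diff_distrib)
  also have "\<dots> = (\<Sum>k\<le>N. G $ k * nth_int F (p - int k))"
    using assms False by (intro sum.mono_neutral_left) (auto simp: nth_int_def)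
  finally show ?thesis .
qed

text \<open>
  The cut-off N does not lose terms: an exponent that exceeds p leads to a negative position
  in F.
\<close>

lemma nth_int_mult_prod:
  fixes D :: "'b \<Rightarrow> 'a::comm_ring_1 fps"
  assumes "finite A" "p \<le> int N"
  shows "nth_int (F * prod D A) p = (\<Sum>M\<in>monoms_in_box A N.
    (\<Prod>a\<in>A. D a $ Poly_Mapping.lookup M a) * nth_int F (p - (\<Sum>a\<in>A. int (Poly_Mapping.lookup M a))))"
  using assms
proof (induction A arbitrary: p rule: finite_induct)
  case empty
  then show ?case by simp
next
  case (insert b A)
  let ?term = "\<lambda>A p M. (\<Prod>a\<in>A. D a $ Poly_Mapping.lookup M a) * nth_int F (p - (\<Sum>a\<in>A. int (Poly_Mapping.lookup M a)))"
  have "nth_int (F * prod D (insert b A)) p = nth_int (F * prod D A * D b) p"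
    using insert.hyps by (simp add: mult_ac)
  also have "\<dots> = (\<Sum>k\<le>N. D b $ k * nth_int (F * prod D A) (p - int k))"
    using insert.prems by (rule nth_int_mult)
  also have "\<dots> = (\<Sum>k\<le>N. D b $ k * (\<Sum>M\<in>monoms_in_box A N. ?term A (p - int k) M))"
    using insert.prems by (intro sum.cong refl arg_cong2[where f = "(*)"] insert.IH) auto
  also have "\<dots> = (\<Sum>k\<le>N. \<Sum>M\<in>monoms_in_box A N. ?term (insert b A) p (M + Poly_Mapping.single b k))"
    unfolding sum_distrib_left
  proof (intro sum.cong refl)
    fix k M assume "M \<in> monoms_in_box A N"
    then have "Poly_Mapping.lookup M b = 0"
      using lookup_outside_box insert.hyps by metis
    then have b: "Poly_Mapping.lookup (M + Poly_Mapping.single b k) b = k"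
      by (simp add: lookup_add)
    have a: "Poly_Mapping.lookup (M + Poly_Mapping.single b k) a = Poly_Mapping.lookup M a" if "a \<in> A" for a
      using that insert.hyps by (auto simp: lookup_add lookup_single when_def)
    show "D b $ k * ?term A (p - int k) M = ?term (insert b A) p (M + Poly_Mapping.single b k)"
      using insert.hyps by (simp add: a b mult.assoc diff_diff_eq cong: sum.cong prod.cong)
  qed
  also have "\<dots> = sum (?term (insert b A) p) (monoms_in_box (A \<union> {b}) N)"
    using insert.hyps
    by (subst sum_monoms_in_box_disjoint_Un) (auto simp: sum_monoms_in_box_single)
  finally show ?case by simp
qed

section \<open>Sums over tuples of variables\<close>

text \<open>
  The tuple factors of the indices in I cancel the part of the weight coming from I, which leaves
  the weight with respect to the other variables. For k in I one of the factors is zero.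
\<close>

lemma pole_weight_remove:
  fixes x :: "nat \<Rightarrow> 'a::field"
  assumes "finite N" "I \<subseteq> N" "k \<in> N" "inj_on x N"
    and nz: "\<And>i j. i \<in> N \<Longrightarrow> j \<in> N \<Longrightarrow> x i + x j \<noteq> 0"
  shows "pole_weight x N k * (\<Prod>i\<in>I. (x k - x i) / (x k + x i)) =
    (if k \<in> I then 0 else pole_weight x (N - I) k)"
proof (cases "k \<in> I")
  case True
  then have "(\<Prod>i\<in>I. (x k - x i) / (x k + x i)) = 0"
    using finite_subset[OF assms(2,1)] by (intro prod_zero bexI[of _ k]) simp_all
  then show ?thesis using True by simp
next
  case False
  have fin: "finite I" using finite_subset[OF assms(2,1)] .
  have split: "N - {k} = (N - I - {k}) \<union> I" using False assms by auto
  have "pole_weight x N k = pole_weight x (N - I) k * (\<Prod>i\<in>I. (x k + x i) / (x k - x i))"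
    unfolding pole_weight_def by (subst split, subst prod.union_disjoint) (use assms fin in auto)
  moreover have "(\<Prod>i\<in>I. (x k + x i) / (x k - x i)) * (\<Prod>i\<in>I. (x k - x i) / (x k + x i)) = 1"
    unfolding prod.distrib[symmetric]
  proof (rule prod.neutral, rule ballI)
    fix i assume i: "i \<in> I"
    then have "x k \<noteq> x i" using False assms by (metis inj_onD subsetD)
    then show "(x k + x i) / (x k - x i) * ((x k - x i) / (x k + x i)) = 1"
      using nz[of k i] assms i by auto
  qed
  ultimately show ?thesis using False by (simp add: mult.assoc)
qed

text \<open>
  The counterpart for series: the factor of a removed variable is inverted by its ratio series.
\<close>

lemma q_gen_remove:
  assumes "finite N" "I \<subseteq> N"
  shows "q_gen x N * (\<Prod>i\<in>I. ratio_series (x i)) = q_gen x (N - I)"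
proof -
  have inv: "(1 + fps_const a * fps_X) * geometric a * ratio_series a = 1" for a :: 'a
  proof -
    have "(1 + fps_const a * fps_X) * geometric a * ratio_series a =
      ((1 - fps_const a * fps_X) * geometric a) * ((1 - fps_const (- a) * fps_X) * geometric (- a))"
      unfolding ratio_series_def by (simp add: mult_ac fps_const_neg[symmetric] del: fps_const_neg)
    then show ?thesis unfolding geometric_inverse by simp
  qed
  have "q_gen x I * (\<Prod>i\<in>I. ratio_series (x i)) = 1"
    unfolding q_gen_def prod.distrib[symmetric] inv by simp
  moreover have "q_gen x N = q_gen x (N - I) * q_gen x I"
    unfolding q_gen_def using assms by (simp only: prod.subset_diff)
  ultimately show ?thesis by (simp add: mult.assoc)
qed

text \<open>
  The summand with k in I vanishes, so this is the coefficient of s^p in the partial fraction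
  expansion for the complement of I. Its constant term is (-1)^|I| because the total number of
  variables is even.
\<close>

lemma sum_pole_weight_power:
  fixes x :: "nat \<Rightarrow> 'a::field"
  assumes "finite N" "even (card N)" "I \<subseteq> N" "inj_on x N"
    and nz: "\<And>i j. i \<in> N \<Longrightarrow> j \<in> N \<Longrightarrow> x i + x j \<noteq> 0"
  shows "(\<Sum>k\<in>N. 2 * pole_weight x N k * (\<Prod>i\<in>I. (x k - x i) / (x k + x i)) * x k ^ p) =
    (q_gen x N * (\<Prod>i\<in>I. ratio_series (x i))) $ p - (if p = 0 then (- 1) ^ card I else 0)"
proof -
  have "(\<Sum>k\<in>N. 2 * pole_weight x N k * (\<Prod>i\<in>I. (x k - x i) / (x k + x i)) * x k ^ p) =
      (\<Sum>k\<in>N. if k \<in> I then 0 else 2 * pole_weight x (N - I) k * x k ^ p)"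
    using pole_weight_remove[OF assms(1,3) _ assms(4) nz]
    by (intro sum.cong refl) (simp add: mult.assoc)
  also have "\<dots> = (\<Sum>k\<in>N - I. 2 * pole_weight x (N - I) k * x k ^ p)"
    using assms by (intro sum.mono_neutral_cong_right) auto
  finally have 1: "(\<Sum>k\<in>N. 2 * pole_weight x N k * (\<Prod>i\<in>I. (x k - x i) / (x k + x i)) * x k ^ p) =
    (\<Sum>k\<in>N - I. 2 * pole_weight x (N - I) k * x k ^ p)" .
  have "card N = card (N - I) + card I"
    using assms(1,3) by (metis card_Diff_subset card_mono finite_subset le_add_diff_inverse2)
  then have "even (card I) \<longleftrightarrow> even (card (N - I))"
    using assms(2) by auto
  then have sign: "(-1 :: 'a) ^ card (N - I) = (-1) ^ card I"
    by (cases "even (card I)") auto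
  have "q_gen x (N - I) $ p = (if p = 0 then (- 1) ^ card I else 0) +
     (\<Sum>k\<in>N - I. 2 * pole_weight x (N - I) k * x k ^ p)"
    using partial_fractions_series[of "N - I" x] assms
    by (simp add: inj_on_diff fps_sum_nth sign geometric_def)
  then show ?thesis
    unfolding 1 using assms by (simp add: q_gen_remove)
qed

text \<open>
  The polynomial (1 - t_1 s) ... (1 - t_b s). The factors c with superscript b are the
  coefficients of its product with the q-series.
\<close>

definition e_gen :: "(nat \<Rightarrow> 'a::comm_ring_1) \<Rightarrow> nat \<Rightarrow> 'a fps" where
  "e_gen t b = Abs_fps (\<lambda>j. elem_sym b j (\<lambda>i. - t i))"

lemma elem_sym_eq_0: "r < j \<Longrightarrow> elem_sym r j a = 0"
proof -
  assume "r < j"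
  then have "card S \<noteq> j" if "S \<subseteq> {1..r}" for S
    using card_mono[OF _ that] by auto
  then show ?thesis unfolding elem_sym_def by (intro sum.neutral) auto
qed

lemma double_power_expand:
  "double_power y t b = (\<Sum>j\<le>b. elem_sym b j (\<lambda>i. - t i) * y ^ (b - j))"
proof -
  have "double_power y t b = (\<Prod>k\<in>{1..b}. - t k + y)"
    by (simp add: double_power_def)
  also have "\<dots> = (\<Sum>S\<in>Pow {1..b}. (\<Prod>k\<in>S. - t k) * y ^ (b - card S))"
    unfolding prod_add[OF finite_atLeastAtMost]
    by (intro sum.cong refl) (auto simp: card_Diff_subset finite_subset)
  also have "\<dots> = (\<Sum>j\<le>b. \<Sum>S\<in>{S \<in> Pow {1..b}. card S = j}. (\<Prod>k\<in>S. - t k) * y ^ (b - card S))"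
    by (rule sum.group[symmetric]) (auto dest: card_mono[rotated])
  also have "\<dots> = (\<Sum>j\<le>b. elem_sym b j (\<lambda>i. - t i) * y ^ (b - j))"
    unfolding elem_sym_def sum_distrib_right by (intro sum.cong) auto
  finally show ?thesis .
qed

text \<open>
  The factor x^(p - b) makes the statement stable under raising operators, which increase p and
  keep b. In the expansion of the double power, only the term of degree p in t can be affected by
  the constant term of the partial fractions, and such a term exists only if p = b.
\<close>

lemma sum_pole_weight_double_power:
  fixes x :: "nat \<Rightarrow> 'a::field"
  assumes "finite N" "even (card N)" "I \<subseteq> N" "inj_on x N"
    and nz: "\<And>i j. i \<in> N \<Longrightarrow> j \<in> N \<Longrightarrow> x i + x j \<noteq> 0"
    and "b \<le> p"
  shows "(\<Sum>k\<in>N. 2 * pole_weight x N k * (\<Prod>i\<in>I. (x k - x i) / (x k + x i)) *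
      (x k ^ (p - b) * double_power (x k) t b)) =
    (q_gen x N * e_gen t b * (\<Prod>i\<in>I. ratio_series (x i))) $ p -
    (if p = b then (- 1) ^ card I * elem_sym b b (\<lambda>i. - t i) else 0)"
proof -
  let ?e = "\<lambda>j. elem_sym b j (\<lambda>i. - t i)"
  let ?F = "q_gen x N * (\<Prod>i\<in>I. ratio_series (x i))"
  let ?w = "\<lambda>k. 2 * pole_weight x N k * (\<Prod>i\<in>I. (x k - x i) / (x k + x i))"
  have pow: "x k ^ (p - b) * double_power (x k) t b = (\<Sum>j\<le>b. ?e j * x k ^ (p - j))" for k
    unfolding double_power_expand sum_distrib_left
  proof (intro sum.cong refl)
    fix j assume "j \<in> {..b}"
    then have "p - j = (p - b) + (b - j)" using \<open>b \<le> p\<close> by auto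
    then show "x k ^ (p - b) * (?e j * x k ^ (b - j)) = ?e j * x k ^ (p - j)"
      by (simp add: power_add)
  qed
  have "(\<Sum>k\<in>N. ?w k * (x k ^ (p - b) * double_power (x k) t b)) =
      (\<Sum>j\<le>b. ?e j * (\<Sum>k\<in>N. ?w k * x k ^ (p - j)))"
    unfolding pow sum_distrib_left by (subst sum.swap) (simp add: mult_ac)
  also have "\<dots> = (\<Sum>j\<le>b. ?e j * ?F $ (p - j)) - (\<Sum>j\<le>b. if p = j then (-1) ^ card I * ?e j else 0)"
    unfolding sum_subtractf[symmetric]
  proof (intro sum.cong refl)
    fix j assume "j \<in> {..b}"
    then have "p - j = 0 \<longleftrightarrow> p = j" using \<open>b \<le> p\<close> by auto
    then have "(\<Sum>k\<in>N. ?w k * x k ^ (p - j)) = ?F $ (p - j) - (if p = j then (-1) ^ card I else 0)"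
      using sum_pole_weight_power[OF assms(1-4) nz, of "p - j"] by presburger
    then show "?e j * (\<Sum>k\<in>N. ?w k * x k ^ (p - j)) =
        ?e j * ?F $ (p - j) - (if p = j then (-1) ^ card I * ?e j else 0)"
      by (simp add: right_diff_distrib)
  qed
  also have "(\<Sum>j\<le>b. if p = j then (-1) ^ card I * ?e j else 0) =
      (if p = b then (- 1) ^ card I * ?e b else 0)"
    using \<open>b \<le> p\<close> by (auto simp: sum.delta)
  also have "(\<Sum>j\<le>b. ?e j * ?F $ (p - j)) = (\<Sum>j=0..p. ?e j * ?F $ (p - j))"
    using \<open>b \<le> p\<close> by (intro sum.mono_neutral_left) (auto simp: elem_sym_eq_0)
  also have "\<dots> = (e_gen t b * ?F) $ p"
    by (simp add: fps_mult_nth e_gen_def)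
  finally show ?thesis by (simp add: mult_ac)
qed

lemma ratio_series_nth:
  "ratio_series y $ m = (if m = 0 then 1 else 2 * (- y) ^ m)"
  by (cases m) (simp_all add: ratio_series_def geometric_def left_diff_distrib mult.assoc)

lemma ratio_series_nth_scale: "ratio_series y $ m = ratio_series 1 $ m * y ^ m"
  by (simp add: ratio_series_nth power_minus[of y])

lemma pairs_0 [simp]: "pairs 0 = {}"
  by (auto simp: pairs_def)

lemma pairs_Suc: "pairs (Suc l) = pairs l \<union> (\<lambda>i. (i, Suc l)) ` {1..l}"
  by (auto simp: pairs_def)

lemma finite_pairs [simp]: "finite (pairs l)"
  by (rule finite_subset[of _ "{1..l} \<times> {1..l}"]) (auto simp: pairs_def)

lemma prod_pairs_Suc:
  "(\<Prod>(i, j)\<in>pairs (Suc l). g i j) = (\<Prod>(i, j)\<in>pairs l. g i j) * (\<Prod>i=1..l. g i (Suc l))"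
proof -
  have "pairs l \<inter> (\<lambda>i. (i, Suc l)) ` {1..l} = {}" by (auto simp: pairs_def)
  then show ?thesis
    unfolding pairs_Suc by (simp add: prod.union_disjoint prod.reindex inj_on_def)
qed

text \<open>
  In position k the superscript is \<open>be k\<close> and the subscript is \<open>a k\<close>, at least \<open>be k\<close>; the double
  Schur P-function corresponds to \<open>a = be\<close>. The factor 2 in each position cancels the power of 2
  in the theorem.
\<close>

definition tuple_term ::
  "(nat \<Rightarrow> 'a::field) \<Rightarrow> (nat \<Rightarrow> 'a) \<Rightarrow> nat set \<Rightarrow> nat \<Rightarrow> (nat \<Rightarrow> nat) \<Rightarrow> (nat \<Rightarrow> nat) \<Rightarrow> (nat \<Rightarrow> nat) \<Rightarrow> 'a"
  where
  "tuple_term x t N l be a f =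
     (\<Prod>k=1..l. 2 * pole_weight x N (f k) * (x (f k) ^ (a k - be k) * double_power (x (f k)) t (be k))) *
     (\<Prod>(i, j)\<in>pairs l. (x (f j) - x (f i)) / (x (f j) + x (f i)))"

definition tuple_sum ::
  "(nat \<Rightarrow> 'a::field) \<Rightarrow> (nat \<Rightarrow> 'a) \<Rightarrow> nat set \<Rightarrow> nat \<Rightarrow> (nat \<Rightarrow> nat) \<Rightarrow> (nat \<Rightarrow> nat) \<Rightarrow> 'a"
  where
  "tuple_sum x t N l be a = (\<Sum>f\<in>{1..l} \<rightarrow>\<^sub>E N. tuple_term x t N l be a f)"

lemma tuple_term_not_inj:
  assumes "\<not> inj_on f {1..l}"
  shows "tuple_term x t N l be a f = 0"
proof -
  obtain i j where "i \<in> {1..l}" "j \<in> {1..l}" "i < j" "f i = f j"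
    using assms unfolding inj_on_def by (metis linorder_neqE_nat)
  then have "(\<Prod>(i, j)\<in>pairs l. (x (f j) - x (f i)) / (x (f j) + x (f i))) = 0"
    by (intro prod_zero bexI[of _ "(i, j)"] finite_pairs) (auto simp: pairs_def)
  then show ?thesis by (simp add: tuple_term_def)
qed

lemma tuple_term_Suc:
  "tuple_term x t N (Suc l) be a (f(Suc l := k)) = tuple_term x t N l be a f *
    (2 * pole_weight x N k * (\<Prod>i=1..l. (x k - x (f i)) / (x k + x (f i))) *
      (x k ^ (a (Suc l) - be (Suc l)) * double_power (x k) t (be (Suc l))))"
proof -
  have "(\<Prod>(i, j)\<in>pairs l. (x ((f(Suc l := k)) j) - x ((f(Suc l := k)) i)) / (x ((f(Suc l := k)) j) + x ((f(Suc l := k)) i))) =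
     (\<Prod>(i, j)\<in>pairs l. (x (f j) - x (f i)) / (x (f j) + x (f i)))"
    by (intro prod.cong) (auto simp: pairs_def)
  then show ?thesis
    unfolding tuple_term_def prod_pairs_Suc
    by (simp add: mult_ac)
qed

text \<open>
  The exponent of the symbol (i, l + 1) in M is the power taken from the ratio series of the i-th
  entry of the tuple: it appears as a power of \<open>x (f i)\<close>, which raises the subscript in position
  i, and it lowers the subscript in the last position.
\<close>

lemma sum_last_index:
  fixes x :: "nat \<Rightarrow> 'a::field"
  assumes "finite N" "even (card N)" "inj_on x N"
    and nz: "\<And>i j. i \<in> N \<Longrightarrow> j \<in> N \<Longrightarrow> x i + x j \<noteq> 0"
    and f: "f ` {1..l} \<subseteq> N" "inj_on f {1..l}" and "b \<le> p" "p \<le> K"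
  defines "T \<equiv> (\<lambda>i. (i, Suc l)) ` {1..l}"
  shows "(\<Sum>k\<in>N. 2 * pole_weight x N k * (\<Prod>i=1..l. (x k - x (f i)) / (x k + x (f i))) *
      (x k ^ (p - b) * double_power (x k) t b)) =
    (\<Sum>M\<in>monoms_in_box T K. (\<Prod>i=1..l. ratio_series 1 $ Poly_Mapping.lookup M (i, Suc l) *
         x (f i) ^ Poly_Mapping.lookup M (i, Suc l)) *
       nth_int (q_gen x N * e_gen t b) (int p - (\<Sum>i=1..l. int (Poly_Mapping.lookup M (i, Suc l))))) -
    (if p = b then (- 1) ^ l * elem_sym b b (\<lambda>i. - t i) else 0)"
proof -
  have inj: "inj_on (\<lambda>i. (i, Suc l)) {1..l}" by (auto simp: inj_on_def)
  have re: "(\<Prod>i\<in>f ` {1..l}. g i) = (\<Prod>i=1..l. g (f i))" for g :: "nat \<Rightarrow> 'b::comm_monoid_mult"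
    using f by (simp add: prod.reindex)
  have "(q_gen x N * e_gen t b * (\<Prod>i=1..l. ratio_series (x (f i)))) $ p =
      nth_int (q_gen x N * e_gen t b * (\<Prod>c\<in>T. ratio_series (x (f (fst c))))) (int p)"
    using inj by (simp add: nth_int_def T_def prod.reindex)
  also have "\<dots> = (\<Sum>M\<in>monoms_in_box T K. (\<Prod>c\<in>T. ratio_series (x (f (fst c))) $ Poly_Mapping.lookup M c) *
       nth_int (q_gen x N * e_gen t b) (int p - (\<Sum>c\<in>T. int (Poly_Mapping.lookup M c))))"
    using \<open>p \<le> K\<close> by (intro nth_int_mult_prod) (auto simp: T_def)
  also have "\<dots> = (\<Sum>M\<in>monoms_in_box T K. (\<Prod>i=1..l. ratio_series 1 $ Poly_Mapping.lookup M (i, Suc l) *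
         x (f i) ^ Poly_Mapping.lookup M (i, Suc l)) *
       nth_int (q_gen x N * e_gen t b) (int p - (\<Sum>i=1..l. int (Poly_Mapping.lookup M (i, Suc l)))))"
    using inj by (simp add: T_def prod.reindex sum.reindex flip: ratio_series_nth_scale)
  finally show ?thesis
    using sum_pole_weight_double_power[OF assms(1,2) f(1) assms(3) nz \<open>b \<le> p\<close>, of t]
    unfolding re card_image[OF f(2)] by simp
qed

lemma tuple_term_shift:
  assumes "\<And>i. i \<in> {1..l} \<Longrightarrow> be i \<le> a i"
  shows "tuple_term x t N l be a f * (\<Prod>i=1..l. x (f i) ^ m i) =
    tuple_term x t N l be (\<lambda>i. a i + m i) f"
proof -
  have shift: "(\<Prod>k=1..l. 2 * pole_weight x N (f k) * (x (f k) ^ (a k - be k) * double_power (x (f k)) t (be k))) *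
     (\<Prod>i=1..l. x (f i) ^ m i) = (\<Prod>k=1..l. 2 * pole_weight x N (f k) * (x (f k) ^ (a k + m k - be k) * double_power (x (f k)) t (be k)))"
    unfolding prod.distrib[symmetric]
  proof (rule prod.cong[OF refl])
    fix k assume "k \<in> {1..l}"
    then have "a k + m k - be k = (a k - be k) + m k" using assms[of k] by simp
    then show "2 * pole_weight x N (f k) * (x (f k) ^ (a k - be k) * double_power (x (f k)) t (be k)) *
        x (f k) ^ m k =
      2 * pole_weight x N (f k) * (x (f k) ^ (a k + m k - be k) * double_power (x (f k)) t (be k))"
      by (simp add: power_add)
  qed
  have swap: "u * v * w = u * w * v" for u v w :: 'a
    by (simp only: mult_ac)
  show ?thesis
    unfolding tuple_term_def swap[of _ _ "\<Prod>i=1..l. x (f i) ^ m i"] shift ..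
qed

text \<open>
  The powers of \<open>x (f i)\<close> in \<open>sum_last_index\<close> are absorbed into the subscripts, so that the
  remaining sum over the first l entries is again a sum over tuples.
\<close>

lemma tuple_sum_Suc:
  fixes x :: "nat \<Rightarrow> 'a::field"
  assumes "finite N" "even (card N)" "inj_on x N"
    and nz: "\<And>i j. i \<in> N \<Longrightarrow> j \<in> N \<Longrightarrow> x i + x j \<noteq> 0"
    and le: "\<And>i. i \<in> {1..Suc l} \<Longrightarrow> be i \<le> a i" and "a (Suc l) \<le> K"
  defines "T \<equiv> (\<lambda>i. (i, Suc l)) ` {1..l}"
  shows "tuple_sum x t N (Suc l) be a =
    (\<Sum>M\<in>monoms_in_box T K. (\<Prod>i=1..l. ratio_series 1 $ Poly_Mapping.lookup M (i, Suc l)) *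
       nth_int (q_gen x N * e_gen t (be (Suc l)))
         (int (a (Suc l)) - (\<Sum>i=1..l. int (Poly_Mapping.lookup M (i, Suc l)))) *
       tuple_sum x t N l be (\<lambda>i. a i + Poly_Mapping.lookup M (i, Suc l))) +
    (if a (Suc l) = be (Suc l)
      then (- 1) ^ Suc l * elem_sym (be (Suc l)) (be (Suc l)) (\<lambda>i. - t i) else 0) *
    tuple_sum x t N l be a"
proof -
  let ?S = "{1..l} \<rightarrow>\<^sub>E N"
  let ?W = "tuple_term x t N l be"
  let ?p = "a (Suc l)" and ?b = "be (Suc l)"
  let ?D = "\<lambda>M. \<Prod>i=1..l. ratio_series (1::'a) $ Poly_Mapping.lookup M (i, Suc l)"
  let ?c = "\<lambda>M. nth_int (q_gen x N * e_gen t ?b)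
         (int ?p - (\<Sum>i=1..l. int (Poly_Mapping.lookup M (i, Suc l))))"
  let ?e = "if ?p = ?b then (- 1) ^ l * elem_sym ?b ?b (\<lambda>i. - t i) else 0"
  have ins: "{1..Suc l} = insert (Suc l) {1..l}" by auto
  have "tuple_sum x t N (Suc l) be a = (\<Sum>(k, f)\<in>N \<times> ?S. tuple_term x t N (Suc l) be a (f(Suc l := k)))"
    unfolding tuple_sum_def ins PiE_insert_eq
    by (subst sum.reindex[OF inj_combinator]) (simp_all add: case_prod_unfold)
  also have "\<dots> = (\<Sum>f\<in>?S. \<Sum>k\<in>N. tuple_term x t N (Suc l) be a (f(Suc l := k)))"
    unfolding sum.cartesian_product[symmetric] by (rule sum.swap)
  also have "\<dots> = (\<Sum>f\<in>?S. ?W a f * (\<Sum>k\<in>N.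
    (2 * pole_weight x N k * (\<Prod>i=1..l. (x k - x (f i)) / (x k + x (f i))) *
      (x k ^ (?p - ?b) * double_power (x k) t ?b))))"
    unfolding tuple_term_Suc sum_distrib_left ..
  also have "\<dots> = (\<Sum>f\<in>?S. ?W a f *
    ((\<Sum>M\<in>monoms_in_box T K. (\<Prod>i=1..l. ratio_series 1 $ Poly_Mapping.lookup M (i, Suc l) *
         x (f i) ^ Poly_Mapping.lookup M (i, Suc l)) * ?c M) - ?e))"
  proof (intro sum.cong refl)
    fix f assume f: "f \<in> ?S"
    show "?W a f * (\<Sum>k\<in>N.
      (2 * pole_weight x N k * (\<Prod>i=1..l. (x k - x (f i)) / (x k + x (f i))) *
        (x k ^ (?p - ?b) * double_power (x k) t ?b))) = ?W a f *
      ((\<Sum>M\<in>monoms_in_box T K. (\<Prod>i=1..l. ratio_series 1 $ Poly_Mapping.lookup M (i, Suc l) *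
         x (f i) ^ Poly_Mapping.lookup M (i, Suc l)) * ?c M) - ?e)"
    proof (cases "inj_on f {1..l}")
      case True
      have "f ` {1..l} \<subseteq> N" using f by auto
      then show ?thesis
        unfolding T_def using le[of "Suc l"] True assms(1-3,6) nz
        by (subst sum_last_index[where K = K]) auto
    qed (simp add: tuple_term_not_inj)
  qed
  also have "\<dots> = (\<Sum>f\<in>?S. \<Sum>M\<in>monoms_in_box T K. ?D M * ?c M *
      ?W (\<lambda>i. a i + Poly_Mapping.lookup M (i, Suc l)) f) - ?e * tuple_sum x t N l be a"
    unfolding tuple_sum_def sum_distrib_left right_diff_distrib sum_subtractf
  proof (intro arg_cong2[where f = "(-)"] sum.cong refl)
    fix f M assume f: "f \<in> ?S"
    have "?W a f * (\<Prod>i=1..l. x (f i) ^ Poly_Mapping.lookup M (i, Suc l)) =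
      ?W (\<lambda>i. a i + Poly_Mapping.lookup M (i, Suc l)) f"
      using le by (intro tuple_term_shift) auto
    then show "?W a f * ((\<Prod>i=1..l. ratio_series 1 $ Poly_Mapping.lookup M (i, Suc l) *
         x (f i) ^ Poly_Mapping.lookup M (i, Suc l)) * ?c M) = ?D M * ?c M *
      ?W (\<lambda>i. a i + Poly_Mapping.lookup M (i, Suc l)) f"
      unfolding prod.distrib by (simp add: mult_ac)
  qed (simp add: mult_ac)
  also have "(\<Sum>f\<in>?S. \<Sum>M\<in>monoms_in_box T K. ?D M * ?c M *
      ?W (\<lambda>i. a i + Poly_Mapping.lookup M (i, Suc l)) f) = (\<Sum>M\<in>monoms_in_box T K. ?D M * ?c M *
      tuple_sum x t N l be (\<lambda>i. a i + Poly_Mapping.lookup M (i, Suc l)))"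
    unfolding tuple_sum_def sum_distrib_left by (rule sum.swap)
  finally show ?thesis by auto
qed

section \<open>Symmetrisation over permutations\<close>

text \<open>
  Any one extension w0 gives all of them as \<open>w0 \<circ> v\<close>, where v permutes l + 1, ..., n.
\<close>

lemma card_permutations_extending:
  assumes f: "f \<in> {1..l} \<rightarrow>\<^sub>E {1..n}" "inj_on f {1..l}"
  shows "card {w. w permutes {1..n} \<and> restrict w {1..l} = f} = fact (n - l)"
proof -
  have sub: "f ` {1..l} \<subseteq> {1..n}" using f by auto
  have ln: "l \<le> n" using card_mono[OF _ sub] card_image[OF f(2)] by simp
  have "card {l + 1..n} = card ({1..n} - f ` {1..l})"
    using sub card_image[OF f(2)] by (simp add: card_Diff_subset)
  then obtain g where g: "bij_betw g {l + 1..n} ({1..n} - f ` {1..l})"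
    by (metis finite_same_card_bij finite_atLeastAtMost finite_Diff)
  define w0 where "w0 i = (if i \<in> {1..l} then f i else if i \<in> {l + 1..n} then g i else i)" for i
  have "bij_betw w0 {1..l} (f ` {1..l})"
    using inj_on_imp_bij_betw[OF f(2)]
    by (rule bij_betw_cong[THEN iffD1, rotated]) (simp add: w0_def)
  moreover have "bij_betw w0 {l + 1..n} ({1..n} - f ` {1..l})"
    using g by (rule bij_betw_cong[THEN iffD1, rotated]) (simp add: w0_def)
  ultimately have "bij_betw w0 ({1..l} \<union> {l + 1..n}) (f ` {1..l} \<union> ({1..n} - f ` {1..l}))"
    by (rule bij_betw_combine) auto
  moreover have "{1..l} \<union> {l + 1..n} = {1..n}" "f ` {1..l} \<union> ({1..n} - f ` {1..l}) = {1..n}"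
    using sub ln by auto
  ultimately have w0: "w0 permutes {1..n}"
    by (intro bij_imp_permutes) (auto simp: w0_def)
  have "bij_betw (\<lambda>v. w0 \<circ> v) {v. v permutes {l + 1..n}}
     {w. w permutes {1..n} \<and> restrict w {1..l} = f}"
  proof (rule bij_betw_byWitness[where f' = "\<lambda>w. inv w0 \<circ> w"])
    show "\<forall>v\<in>{v. v permutes {l + 1..n}}. inv w0 \<circ> (w0 \<circ> v) = v"
      using permutes_inv_o(2)[OF w0] by (simp add: o_assoc)
    show "\<forall>w\<in>{w. w permutes {1..n} \<and> restrict w {1..l} = f}. w0 \<circ> (inv w0 \<circ> w) = w"
      using permutes_inv_o(1)[OF w0] by (simp add: o_assoc)
    show "(\<lambda>v. w0 \<circ> v) ` {v. v permutes {l + 1..n}} \<subseteq> {w. w permutes {1..n} \<and> restrict w {1..l} = f}"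
    proof safe
      fix v assume v: "v permutes {l + 1..n}"
      then have "v permutes {1..n}" by (rule permutes_subset) auto
      then show "w0 \<circ> v permutes {1..n}" using w0 by (rule permutes_compose)
      show "restrict (w0 \<circ> v) {1..l} = f"
      proof
        fix i
        show "restrict (w0 \<circ> v) {1..l} i = f i"
          using f(1) permutes_not_in[OF v, of i]
          by (cases "i \<in> {1..l}") (auto simp: w0_def PiE_def extensional_def)
      qed
    qed
    show "(\<lambda>w. inv w0 \<circ> w) ` {w. w permutes {1..n} \<and> restrict w {1..l} = f} \<subseteq> {v. v permutes {l + 1..n}}"
    proof safe
      fix w assume w: "w permutes {1..n}" and r: "f = restrict w {1..l}"
      have "inv w0 \<circ> w permutes {1..n}"
        using w permutes_inv[OF w0] by (rule permutes_compose)
      moreover have "(inv w0 \<circ> w) i = i" if "i \<in> {1..n} - {l + 1..n}" for i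
      proof -
        have "w i = w0 i" using that r by (auto simp: w0_def)
        then show ?thesis using permutes_inverses(2)[OF w0] by simp
      qed
      ultimately show "inv w0 \<circ> w permutes {l + 1..n}" by (rule permutes_superset)
    qed
  qed
  then have "card {w. w permutes {1..n} \<and> restrict w {1..l} = f} = card {v. v permutes {l + 1..n}}"
    by (simp add: bij_betw_same_card)
  also have "\<dots> = fact (n - l)" by (rule card_permutations) auto
  finally show ?thesis .
qed

lemma sum_permutations_eq_sum_injections:
  fixes G :: "(nat \<Rightarrow> nat) \<Rightarrow> 'a::comm_semiring_1"
  assumes "l \<le> n"
  shows "(\<Sum>w | w permutes {1..n}. G (restrict w {1..l})) =
    of_nat (fact (n - l)) * (\<Sum>f | f \<in> {1..l} \<rightarrow>\<^sub>E {1..n} \<and> inj_on f {1..l}. G f)"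
proof -
  let ?F = "{f. f \<in> {1..l} \<rightarrow>\<^sub>E {1..n} \<and> inj_on f {1..l}}"
  have "finite ?F"
    by (rule finite_subset[of _ "{1..l} \<rightarrow>\<^sub>E {1..n}"]) (auto intro!: finite_PiE)
  moreover have "(\<lambda>w. restrict w {1..l}) ` {w. w permutes {1..n}} \<subseteq> ?F"
  proof (rule image_subsetI)
    fix w assume "w \<in> {w. w permutes {1..n}}"
    then have w: "w permutes {1..n}" by simp
    have "restrict w {1..l} \<in> {1..l} \<rightarrow>\<^sub>E {1..n}"
      using permutes_in_image[OF w] assms by auto
    moreover have "inj_on (restrict w {1..l}) {1..l}"
      using permutes_inj[OF w] by (auto simp: inj_on_def)
    ultimately show "restrict w {1..l} \<in> ?F" by simp
  qed
  ultimately have "(\<Sum>w | w permutes {1..n}. G (restrict w {1..l})) =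
     (\<Sum>f\<in>?F. \<Sum>w\<in>{w \<in> {w. w permutes {1..n}}. restrict w {1..l} = f}. G (restrict w {1..l}))"
    by (intro sum.group[symmetric]) (auto simp: finite_permutations)
  also have "\<dots> = (\<Sum>f\<in>?F. of_nat (fact (n - l)) * G f)"
    by (intro sum.cong refl) (simp add: card_permutations_extending del: One_nat_def)
  finally show ?thesis by (simp add: sum_distrib_left)
qed

lemma prod_off_diagonal:
  "(\<Prod>i=1..l. \<Prod>j\<in>{1..l} - {i}. g i j) = (\<Prod>(i, j)\<in>pairs l. g i j * g j i)"
  for g :: "nat \<Rightarrow> nat \<Rightarrow> 'a::comm_monoid_mult"
proof (induction l)
  case 0
  show ?case by simp
next
  case (Suc l)
  have "(\<Prod>i=1..Suc l. \<Prod>j\<in>{1..Suc l} - {i}. g i j) =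
      (\<Prod>i=1..l. \<Prod>j\<in>{1..Suc l} - {i}. g i j) * (\<Prod>j\<in>{1..Suc l} - {Suc l}. g (Suc l) j)"
    by simp
  also have "{1..Suc l} - {Suc l} = {1..l}" by auto
  also have "(\<Prod>i=1..l. \<Prod>j\<in>{1..Suc l} - {i}. g i j) =
     (\<Prod>i=1..l. g i (Suc l) * (\<Prod>j\<in>{1..l} - {i}. g i j))"
  proof (intro prod.cong refl)
    fix i assume "i \<in> {1..l}"
    then have "{1..Suc l} - {i} = insert (Suc l) ({1..l} - {i})" by auto
    then show "(\<Prod>j\<in>{1..Suc l} - {i}. g i j) = g i (Suc l) * (\<Prod>j\<in>{1..l} - {i}. g i j)"
      by simp
  qed
  also have "\<dots> = (\<Prod>i=1..l. g i (Suc l)) * (\<Prod>(i, j)\<in>pairs l. g i j * g j i)"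
    by (simp only: prod.distrib Suc.IH)
  finally show ?case
    by (simp only: prod_pairs_Suc prod.distrib mult_ac)
qed

text \<open>
  The product of the weights of the first l entries contains both ratios r i j and r j i for each
  pair among them; the tuple factor of the pair is the inverse of the second.
\<close>

lemma tuple_term_permutation:
  fixes x :: "nat \<Rightarrow> 'a::field"
  assumes w: "w permutes {1..n}" and "l \<le> n" and inj: "inj_on x {1..n}"
    and nz: "\<And>i j. i \<in> {1..n} \<Longrightarrow> j \<in> {1..n} \<Longrightarrow> x i + x j \<noteq> 0"
  shows "tuple_term x t {1..n} l be be (restrict w {1..l}) =
    2 ^ l * ((\<Prod>i=1..l. double_power (x (w i)) t (be i)) *
     (\<Prod>(i, j)\<in>{(i, j). 1 \<le> i \<and> i \<le> l \<and> i < j \<and> j \<le> n}.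
        (x (w i) + x (w j)) / (x (w i) - x (w j))))"
proof -
  define r where "r i j = (x (w i) + x (w j)) / (x (w i) - x (w j))" for i j
  have winj: "inj w" using w by (rule permutes_inj)
  have win: "w i \<in> {1..n}" if "i \<in> {1..n}" for i using permutes_in_image[OF w] that by auto
  have pole_weight: "pole_weight x {1..n} (w i) = (\<Prod>j\<in>{1..l} - {i}. r i j) * (\<Prod>j=l+1..n. r i j)"
    if "i \<in> {1..l}" for i
  proof -
    have "{1..n} - {w i} = w ` ({1..n} - {i})"
      using permutes_image[OF w] winj by (simp add: image_set_diff)
    then have "pole_weight x {1..n} (w i) = (\<Prod>j\<in>{1..n} - {i}. r i j)"
      unfolding pole_weight_def r_def using winj by (simp add: prod.reindex inj_on_def)
    also have "{1..n} - {i} = ({1..l} - {i}) \<union> {l+1..n}"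
      using that \<open>l \<le> n\<close> by auto
    also have "(\<Prod>j\<in>\<dots>. r i j) = (\<Prod>j\<in>{1..l} - {i}. r i j) * (\<Prod>j=l+1..n. r i j)"
      by (rule prod.union_disjoint) auto
    finally show ?thesis .
  qed
  have cancel: "(\<Prod>(i, j)\<in>pairs l. r i j * r j i) *
      (\<Prod>(i, j)\<in>pairs l. (x (w j) - x (w i)) / (x (w j) + x (w i))) = (\<Prod>(i, j)\<in>pairs l. r i j)"
    unfolding prod.distrib[symmetric]
  proof (intro prod.cong refl, clarify)
    fix i j assume "(i, j) \<in> pairs l"
    then have ij: "i \<in> {1..n}" "j \<in> {1..n}" "i \<noteq> j" using \<open>l \<le> n\<close> by (auto simp: pairs_def)
    then have "w i \<noteq> w j" using winj by (auto dest: injD)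
    then have "x (w j) \<noteq> x (w i)" using inj win[OF ij(1)] win[OF ij(2)] by (metis inj_onD)
    moreover have "x (w j) + x (w i) \<noteq> 0" using nz win ij by auto
    ultimately show "r i j * r j i * ((x (w j) - x (w i)) / (x (w j) + x (w i))) = r i j"
      unfolding r_def[of j i] by simp
  qed
  have split: "{(i, j). 1 \<le> i \<and> i \<le> l \<and> i < j \<and> j \<le> n} = pairs l \<union> {1..l} \<times> {l+1..n}"
    using \<open>l \<le> n\<close> by (auto simp: pairs_def)
  have "tuple_term x t {1..n} l be be (restrict w {1..l}) =
      (\<Prod>k=1..l. 2 * pole_weight x {1..n} (w k) * double_power (x (w k)) t (be k)) *
      (\<Prod>(i, j)\<in>pairs l. (x (w j) - x (w i)) / (x (w j) + x (w i)))"
    unfolding tuple_term_def by (intro arg_cong2[where f = "(*)"] prod.cong) (auto simp: pairs_def)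
  also have "(\<Prod>k=1..l. 2 * pole_weight x {1..n} (w k) * double_power (x (w k)) t (be k)) =
      2 ^ l * (\<Prod>k=1..l. double_power (x (w k)) t (be k)) *
      ((\<Prod>i=1..l. \<Prod>j\<in>{1..l} - {i}. r i j) * (\<Prod>i=1..l. \<Prod>j=l+1..n. r i j))"
  proof -
    have "(\<Prod>k=1..l. 2 * pole_weight x {1..n} (w k) * double_power (x (w k)) t (be k)) =
      (\<Prod>i=1..l. 2 * ((\<Prod>j\<in>{1..l} - {i}. r i j) * (\<Prod>j=l+1..n. r i j)) * double_power (x (w i)) t (be i))"
      by (intro prod.cong refl) (simp only: pole_weight)
    then show ?thesis by (simp add: prod.distrib mult_ac)
  qed
  also have "\<dots> * (\<Prod>(i, j)\<in>pairs l. (x (w j) - x (w i)) / (x (w j) + x (w i))) =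
      2 ^ l * (\<Prod>k=1..l. double_power (x (w k)) t (be k)) *
       ((\<Prod>(i, j)\<in>pairs l. r i j) * (\<Prod>i=1..l. \<Prod>j=l+1..n. r i j))"
    unfolding prod_off_diagonal cancel[symmetric] by (simp only: mult_ac)
  also have "(\<Prod>(i, j)\<in>pairs l. r i j) * (\<Prod>i=1..l. \<Prod>j=l+1..n. r i j) =
      (\<Prod>(i, j)\<in>{(i, j). 1 \<le> i \<and> i \<le> l \<and> i < j \<and> j \<le> n}. r i j)"
  proof -
    have "pairs l \<inter> {1..l} \<times> {l+1..n} = {}" by (auto simp: pairs_def)
    then show ?thesis
      unfolding split by (simp add: prod.union_disjoint prod.cartesian_product)
  qed
  finally show ?thesis by (simp only: r_def mult.assoc)
qed

lemma ivanov_sum_eq_tuple_sum: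
  fixes x :: "nat \<Rightarrow> 'a::field"
  assumes "l \<le> n" and inj: "inj_on x {1..n}"
    and nz: "\<And>i j. i \<in> {1..n} \<Longrightarrow> j \<in> {1..n} \<Longrightarrow> x i + x j \<noteq> 0"
  shows "2 ^ l * (\<Sum>w | w permutes {1..n}. (\<Prod>i=1..l. double_power (x (w i)) t (be i)) *
     (\<Prod>(i, j)\<in>{(i, j). 1 \<le> i \<and> i \<le> l \<and> i < j \<and> j \<le> n}.
        (x (w i) + x (w j)) / (x (w i) - x (w j)))) =
     of_nat (fact (n - l)) * tuple_sum x t {1..n} l be be"
proof -
  have "(\<Sum>f | f \<in> {1..l} \<rightarrow>\<^sub>E {1..n} \<and> inj_on f {1..l}. tuple_term x t {1..n} l be be f) =
      tuple_sum x t {1..n} l be be"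
    unfolding tuple_sum_def
    by (rule sum.mono_neutral_left) (auto intro!: finite_PiE tuple_term_not_inj)
  then have "of_nat (fact (n - l)) * tuple_sum x t {1..n} l be be =
      (\<Sum>w | w permutes {1..n}. tuple_term x t {1..n} l be be (restrict w {1..l}))"
    by (simp only: sum_permutations_eq_sum_injections[OF \<open>l \<le> n\<close>])
  then show ?thesis
    unfolding sum_distrib_left
    using tuple_term_permutation[OF _ \<open>l \<le> n\<close> inj nz] by simp
qed

section \<open>Evaluation in finitely many variables\<close>

lemma component_simps [simp]:
  "component 0 m = 0" "component 1 m = 1"
  "component (F + G) m = component F m + component G m"
  "component (- F) m = - component F m"
  "component (F * G) m = component F m * component G m"
  by (simp_all add: zero_xlim.rep_eq one_xlim.rep_eq plus_xlim.rep_eq uminus_xlim.rep_eq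
      times_xlim.rep_eq)

lemma const_poly_hom:
  "const_poly 0 = 0" "const_poly 1 = 1"
  "const_poly (a + b) = const_poly a + const_poly b"
  "const_poly (- a) = - const_poly a"
  "const_poly (a * b) = const_poly a * const_poly b"
  by (simp_all add: const_poly_def single_add single_uminus mult_single)

lemma to_fract_inject: "to_fract a = to_fract b \<longleftrightarrow> a = b"
  by (simp add: eq_fract)

text \<open>
  A member of the family, regarded as a rational function because Ivanov's formula has
  denominators.
\<close>

definition eval_at :: "nat \<Rightarrow> xlim \<Rightarrow> xpoly fract" where
  "eval_at m F = to_fract (component F m)"

lemma eval_at_hom [simp]:
  "eval_at m 0 = 0" "eval_at m 1 = 1"
  "eval_at m (F + G) = eval_at m F + eval_at m G"
  "eval_at m (- F) = - eval_at m F"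
  "eval_at m (F * G) = eval_at m F * eval_at m G"
  by (simp_all add: eval_at_def Zero_fract_def One_fract_def)

lemma eval_at_sum: "eval_at m (sum f A) = (\<Sum>a\<in>A. eval_at m (f a))"
  by (induction A rule: infinite_finite_induct) simp_all

lemma eval_at_power: "eval_at m (F ^ k) = eval_at m F ^ k"
  by (induction k) simp_all

definition t_scalar :: "tpoly \<Rightarrow> xpoly fract" where
  "t_scalar a = to_fract (const_poly a)"

lemma t_scalar_hom:
  "t_scalar 0 = 0" "t_scalar 1 = 1"
  "t_scalar (a + b) = t_scalar a + t_scalar b"
  "t_scalar (- a) = - t_scalar a"
  "t_scalar (a * b) = t_scalar a * t_scalar b"
  by (simp_all add: t_scalar_def const_poly_hom Zero_fract_def One_fract_def)

lemma t_scalar_elem_sym: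
  "t_scalar (elem_sym r j (\<lambda>i. - indet i)) = elem_sym r j (\<lambda>i. - tfrac i)"
proof -
  have prod: "t_scalar (prod f A) = (\<Prod>a\<in>A. t_scalar (f a))" for f and A :: "nat set"
    by (induction A rule: infinite_finite_induct) (simp_all add: t_scalar_hom)
  have sum: "t_scalar (sum f A) = (\<Sum>a\<in>A. t_scalar (f a))" for f and A :: "nat set set"
    by (induction A rule: infinite_finite_induct) (simp_all add: t_scalar_hom)
  have t: "tfrac i = t_scalar (indet i)" for i
    by (simp add: tfrac_def t_scalar_def)
  show ?thesis
    by (simp add: elem_sym_def prod sum t flip: t_scalar_hom(4))
qed

definition rat_scalar :: "rat \<Rightarrow> xpoly fract" where
  "rat_scalar r = t_scalar (const_poly r)"

lemma rat_scalar_hom: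
  "rat_scalar 0 = 0" "rat_scalar 1 = 1"
  "rat_scalar (a + b) = rat_scalar a + rat_scalar b"
  "rat_scalar (- a) = - rat_scalar a"
  "rat_scalar (a * b) = rat_scalar a * rat_scalar b"
  by (simp_all add: rat_scalar_def const_poly_hom t_scalar_hom)

lemma rat_scalar_power: "rat_scalar (a ^ k) = rat_scalar a ^ k"
  by (induction k) (simp_all add: rat_scalar_hom)

lemma rat_scalar_prod: "rat_scalar (prod f A) = (\<Prod>a\<in>A. rat_scalar (f a))"
  by (induction A rule: infinite_finite_induct) (simp_all add: rat_scalar_hom)

lemma eval_at_qconst: "eval_at m (qconst r) = rat_scalar r"
  by (simp add: eval_at_def qconst_def rat_scalar_def t_scalar_def)

lemma ratio_series_one_eq_divide: "(1 - fps_X) / (1 + fps_X) = ratio_series (1 :: rat)"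
proof -
  have inv: "(1 + fps_X) * geometric (- 1 :: rat) = 1"
    using geometric_inverse[of "- 1 :: rat"]
    by (simp add: fps_const_neg[symmetric] del: fps_const_neg)
  have nz: "(1 + fps_X :: rat fps) \<noteq> 0"
    using inv by auto
  have "1 - fps_X = ratio_series (1 :: rat) * (1 + fps_X)"
    using inv by (simp add: ratio_series_def mult_ac)
  then show ?thesis using nz by (metis nonzero_mult_div_cancel_right)
qed

lemma rat_scalar_ratio: "rat_scalar (((1 - fps_X) / (1 + fps_X)) $ k) = ratio_series 1 $ k"
proof -
  have "rat_scalar 2 = 2"
    using rat_scalar_hom(3)[of 1 1] by (simp add: rat_scalar_hom)
  then show ?thesis
    by (simp add: ratio_series_one_eq_divide ratio_series_nth rat_scalar_hom rat_scalar_power)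
qed

lemma to_fract_q_gen: "to_fract (q_gen x A $ r) = q_gen (\<lambda>i. to_fract (x i)) A $ r"
  for x :: "nat \<Rightarrow> 'a::idom"
proof (induction A arbitrary: r rule: infinite_finite_induct)
  case (infinite A)
  then show ?case by (cases r) (simp_all add: q_gen_def One_fract_def Zero_fract_def)
next
  case empty
  then show ?case by (cases r) (simp_all add: q_gen_def One_fract_def Zero_fract_def)
next
  case (insert z A)
  have coeff: "((1 + fps_const a * fps_X) * geometric a) $ k = (if k = 0 then 1 else 2 * a ^ k)"
    for a :: "'c::comm_ring_1" and k
    unfolding factor_geometric by (simp add: geometric_def numeral_fps_const)
  have mult: "to_fract (a * b) = to_fract a * to_fract b" for a b :: 'a by simp
  have power: "to_fract (a ^ k) = to_fract a ^ k" for a :: 'a and k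
    by (induction k) (simp add: One_fract_def, simp only: power_Suc mult)
  have factor: "to_fract (((1 + fps_const a * fps_X) * geometric a) $ k) =
      ((1 + fps_const (to_fract a) * fps_X) * geometric (to_fract a)) $ k" for a :: 'a and k
  proof -
    have "to_fract (2 :: 'a) = 2"
      unfolding one_add_one[symmetric] One_fract_def by simp
    moreover have "to_fract (2 * a ^ k) = to_fract 2 * to_fract (a ^ k)" by simp
    ultimately show ?thesis
      unfolding coeff by (simp only: power One_fract_def split: if_split) simp
  qed
  have plus: "to_fract (a + b) = to_fract a + to_fract b" for a b :: 'a by simp
  have sum: "to_fract (sum f B) = (\<Sum>b\<in>B. to_fract (f b))" for f :: "nat \<Rightarrow> 'a" and B
    by (induction B rule: infinite_finite_induct) (simp_all add: Zero_fract_def plus del: add_fract)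
  have ins: "q_gen y (insert z A) = ((1 + fps_const (y z) * fps_X) * geometric (y z)) * q_gen y A"
    for y :: "nat \<Rightarrow> 'c::comm_ring_1"
    using insert.hyps by (simp add: q_gen_def)
  show ?case
    unfolding ins fps_mult_nth[of "_ * _" "q_gen _ _"] sum
    by (simp only: mult factor insert.IH)
qed

lemma eval_at_q_fun: "eval_at m (q_fun r) = q_gen xfrac {1..2 * m} $ r"
proof -
  have "component (q_fun r) m = q_gen indet {1..2 * m} $ r"
    by (simp add: q_fun.rep_eq q_series_def q_gen_def)
  moreover have "xfrac = (\<lambda>i. to_fract (indet i))"
    by (simp add: xfrac_def fun_eq_iff)
  ultimately show ?thesis
    by (simp add: eval_at_def to_fract_q_gen)
qed

lemma eval_at_e_neg_t: "eval_at m (e_neg_t r j) = elem_sym r j (\<lambda>i. - tfrac i)"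
  by (simp add: eval_at_def e_neg_t_def t_scalar_elem_sym flip: t_scalar_def)

abbreviation c_gen :: "nat \<Rightarrow> nat \<Rightarrow> xpoly fract fps" where
  "c_gen m b \<equiv> q_gen xfrac {1..2 * m} * e_gen tfrac b"

lemma eval_at_c_fun: "eval_at m (c_fun b p) = nth_int (c_gen m b) p"
proof (cases "p < 0")
  case False
  have "eval_at m (c_fun b p) = (e_gen tfrac b * q_gen xfrac {1..2 * m}) $ nat p"
    using False by (simp add: c_fun_def fps_mult_nth eval_at_sum eval_at_q_fun eval_at_e_neg_t
        e_gen_def mult.commute)
  then show ?thesis using False by (simp add: nth_int_def mult.commute)
qed (simp add: c_fun_def nth_int_def)

text \<open>
  What distinguishes the hatted factor in position i from the factor without hat.
\<close>

definition hat_correction :: "nat \<Rightarrow> nat \<Rightarrow> int \<Rightarrow> xpoly fract" where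
  "hat_correction i b p =
     (if int b = p \<and> p > 0 then (- 1) ^ i * elem_sym b b (\<lambda>i. - tfrac i) else 0)"

lemma eval_at_c_hat:
  "eval_at m (c_hat i b p) = nth_int (c_gen m b) p + hat_correction i b p"
  by (auto simp: c_hat_def hat_correction_def eval_at_c_fun eval_at_e_neg_t eval_at_power)

section \<open>Raising operators\<close>

abbreviation last_column :: "nat \<Rightarrow> (nat \<times> nat) set" where
  "last_column l \<equiv> (\<lambda>i. (i, Suc l)) ` {1..l}"

lemma raise_seq_superset:
  assumes "finite A" "Poly_Mapping.keys R \<subseteq> A"
  shows "raise_seq R al k = al k + (\<Sum>(i, j)\<in>A.
    int (Poly_Mapping.lookup R (i, j)) * (of_bool (k = i) - of_bool (k = j)))"
  unfolding raise_seq_def using assms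
  by (intro arg_cong2[where f = "(+)"] refl sum.mono_neutral_left) (auto simp: in_keys_iff)

lemma raise_seq_last_column:
  assumes "Poly_Mapping.keys M \<subseteq> last_column l"
  shows "i \<in> {1..l} \<Longrightarrow> raise_seq M al i = al i + int (Poly_Mapping.lookup M (i, Suc l))"
    and "raise_seq M al (Suc l) = al (Suc l) - (\<Sum>i=1..l. int (Poly_Mapping.lookup M (i, Suc l)))"
proof -
  have *: "raise_seq M al k = al k + (\<Sum>i=1..l. int (Poly_Mapping.lookup M (i, Suc l)) *
      (of_bool (k = i) - of_bool (k = Suc l)))" for k
    by (subst raise_seq_superset[OF _ assms]) (simp_all add: sum.reindex inj_on_def)
  show "raise_seq M al i = al i + int (Poly_Mapping.lookup M (i, Suc l))" if "i \<in> {1..l}"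
  proof -
    have "(\<Sum>j=1..l. int (Poly_Mapping.lookup M (j, Suc l)) * (of_bool (i = j) - of_bool (i = Suc l))) =
       (\<Sum>j=1..l. if i = j then int (Poly_Mapping.lookup M (j, Suc l)) else 0)"
      using that by (intro sum.cong) auto
    then show ?thesis using that unfolding * by simp
  qed
  have "(\<Sum>j=1..l. int (Poly_Mapping.lookup M (j, Suc l)) * (of_bool (Suc l = j) - of_bool (Suc l = Suc l))) =
       (\<Sum>j=1..l. - int (Poly_Mapping.lookup M (j, Suc l)))"
    by (intro sum.cong) auto
  then show "raise_seq M al (Suc l) = al (Suc l) - (\<Sum>i=1..l. int (Poly_Mapping.lookup M (i, Suc l)))"
    unfolding * by (simp add: sum_negf)
qed

lemma supp_add: "supp (R + M) = supp R \<union> supp M"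
  unfolding supp_def
proof -
  have "Poly_Mapping.keys (R + M) = Poly_Mapping.keys R \<union> Poly_Mapping.keys M"
    by (auto simp: in_keys_iff lookup_add)
  then show "(\<Union>(i, j)\<in>Poly_Mapping.keys (R + M). {i, j}) =
      (\<Union>(i, j)\<in>Poly_Mapping.keys R. {i, j}) \<union> (\<Union>(i, j)\<in>Poly_Mapping.keys M. {i, j})"
    by auto
qed

lemma supp_last_column:
  assumes "Poly_Mapping.keys M \<subseteq> last_column l"
  shows "i \<in> {1..l} \<Longrightarrow> i \<in> supp M \<longleftrightarrow> Poly_Mapping.lookup M (i, Suc l) \<noteq> 0"
    and "Suc l \<in> supp M \<longleftrightarrow> M \<noteq> 0"
proof -
  have shape: "\<exists>k\<in>{1..l}. c = (k, Suc l)" if "c \<in> Poly_Mapping.keys M" for c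
    using assms that by auto
  show "i \<in> supp M \<longleftrightarrow> Poly_Mapping.lookup M (i, Suc l) \<noteq> 0" if i: "i \<in> {1..l}"
  proof
    assume "i \<in> supp M"
    then obtain c where c: "c \<in> Poly_Mapping.keys M" "i = fst c \<or> i = snd c"
      by (auto simp: supp_def)
    then have "c = (i, Suc l)" using shape[OF c(1)] i by auto
    then show "Poly_Mapping.lookup M (i, Suc l) \<noteq> 0" using c(1) by (simp add: in_keys_iff)
  next
    assume "Poly_Mapping.lookup M (i, Suc l) \<noteq> 0"
    then have "(i, Suc l) \<in> Poly_Mapping.keys M" by (simp add: in_keys_iff)
    then show "i \<in> supp M" unfolding supp_def by blast
  qed
  show "Suc l \<in> supp M \<longleftrightarrow> M \<noteq> 0"
  proof
    assume "Suc l \<in> supp M"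
    then show "M \<noteq> 0" by (auto simp: supp_def)
  next
    assume "M \<noteq> 0"
    then obtain c where c: "c \<in> Poly_Mapping.keys M" by (metis all_not_in_conv keys_eq_empty)
    then obtain k where "c = (k, Suc l)" using shape by blast
    then show "Suc l \<in> supp M" using c unfolding supp_def by blast
  qed
qed

lemma supp_subset: "Poly_Mapping.keys R \<subseteq> pairs l \<Longrightarrow> supp R \<subseteq> {1..l}"
  unfolding supp_def
proof (rule UN_least)
  fix c assume "c \<in> Poly_Mapping.keys R" "Poly_Mapping.keys R \<subseteq> pairs l"
  then have "c \<in> pairs l" by blast
  then show "(case c of (i, j) \<Rightarrow> {i, j}) \<subseteq> {1..l}" by (auto simp: pairs_def)
qed

text \<open>
  The factors in the first l positions are those of R applied to the sequence raised by M, hats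
  included. A position in the support of M only has no hat on the left. It may have one on the
  right, but there the subscript is strictly larger than the superscript, so that the hat makes
  no difference.
\<close>

lemma star_monom_last_column:
  assumes R: "Poly_Mapping.keys R \<subseteq> pairs l" and M: "Poly_Mapping.keys M \<subseteq> last_column l"
    and le: "\<And>i. i \<in> {1..l} \<Longrightarrow> int (be i) \<le> al i"
  shows "star_monom (Suc l) be al (R + M) =
    star_monom l be (\<lambda>i. al i + int (Poly_Mapping.lookup M (i, Suc l))) R *
    (if M = 0 then c_hat (Suc l) (be (Suc l)) (al (Suc l))
     else c_fun (be (Suc l)) (al (Suc l) - (\<Sum>i=1..l. int (Poly_Mapping.lookup M (i, Suc l)))))"
proof -
  define al' where "al' i = al i + int (Poly_Mapping.lookup M (i, Suc l))" for i
  have sR: "supp R \<subseteq> {1..l}" using R by (rule supp_subset)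
  have raise: "raise_seq (R + M) al i = raise_seq R al' i" if "i \<in> {1..l}" for i
    using raise_seq_last_column(1)[OF M that, of al]
    by (simp add: raise_seq_add raise_seq_def[of R] al'_def)
  have "raise_seq (R + M) al (Suc l) = raise_seq M al (Suc l)"
    using sR by (subst raise_seq_add, subst raise_seq_not_supp) auto
  then have last: "raise_seq (R + M) al (Suc l) =
      al (Suc l) - (\<Sum>i=1..l. int (Poly_Mapping.lookup M (i, Suc l)))"
    using raise_seq_last_column(2)[OF M] by simp
  have "(\<Prod>i=1..l. if i \<in> supp (R + M) then c_fun (be i) (raise_seq (R + M) al i)
          else c_hat i (be i) (raise_seq (R + M) al i)) = star_monom l be al' R"
    unfolding star_monom_def
  proof (intro prod.cong refl)
    fix i assume i: "i \<in> {1..l}"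
    show "(if i \<in> supp (R + M) then c_fun (be i) (raise_seq (R + M) al i)
          else c_hat i (be i) (raise_seq (R + M) al i)) =
        (if i \<in> supp R then c_fun (be i) (raise_seq R al' i) else c_hat i (be i) (raise_seq R al' i))"
    proof (cases "i \<notin> supp R \<and> i \<in> supp M")
      case True
      then have "raise_seq R al' i = al' i" by (simp add: raise_seq_not_supp)
      moreover have "int (be i) < al' i"
        using True le[OF i] supp_last_column(1)[OF M i] by (simp add: al'_def)
      ultimately show ?thesis
        using True i by (simp add: raise supp_add c_hat_def)
    next
      case False
      then show ?thesis using i by (auto simp: raise supp_add)
    qed
  qed
  moreover have "Suc l \<in> supp (R + M) \<longleftrightarrow> M \<noteq> 0"
    using sR supp_last_column(2)[OF M] by (auto simp: supp_add)
  moreover have "star_monom (Suc l) be al (R + M) =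
      (\<Prod>i=1..l. if i \<in> supp (R + M) then c_fun (be i) (raise_seq (R + M) al i)
          else c_hat i (be i) (raise_seq (R + M) al i)) *
      (if Suc l \<in> supp (R + M) then c_fun (be (Suc l)) (raise_seq (R + M) al (Suc l))
       else c_hat (Suc l) (be (Suc l)) (raise_seq (R + M) al (Suc l)))"
    by (simp add: star_monom_def)
  ultimately show ?thesis
    unfolding last al'_def[symmetric] by (cases "M = 0") simp_all
qed

lemma R_infty_last_column:
  assumes R: "Poly_Mapping.keys R \<subseteq> pairs l" and M: "Poly_Mapping.keys M \<subseteq> last_column l"
  shows "R_infty (Suc l) (R + M) =
    R_infty l R * (\<Prod>i=1..l. ((1 - fps_X) / (1 + fps_X)) $ Poly_Mapping.lookup M (i, Suc l))"
proof -
  let ?d = "\<lambda>k. ((1 - fps_X) / (1 + fps_X) :: rat fps) $ k"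
  have M0: "Poly_Mapping.lookup M (i, j) = 0" if "(i, j) \<in> pairs l" for i j
    using M that by (auto simp: pairs_def in_keys_iff)
  have R0: "Poly_Mapping.lookup R (i, Suc l) = 0" for i
    using R by (auto simp: pairs_def in_keys_iff)
  have "Poly_Mapping.keys (R + M) \<subseteq> pairs (Suc l)"
    using R M Poly_Mapping.keys_add[of R M] by (auto simp: pairs_Suc)
  then have "R_infty (Suc l) (R + M) =
      (\<Prod>(i, j)\<in>pairs (Suc l). ?d (Poly_Mapping.lookup (R + M) (i, j)))"
    by (simp add: R_infty_def case_prod_unfold)
  also have "\<dots> = (\<Prod>(i, j)\<in>pairs l. ?d (Poly_Mapping.lookup (R + M) (i, j))) *
      (\<Prod>i=1..l. ?d (Poly_Mapping.lookup (R + M) (i, Suc l)))"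
    by (rule prod_pairs_Suc)
  also have "(\<Prod>(i, j)\<in>pairs l. ?d (Poly_Mapping.lookup (R + M) (i, j))) =
      (\<Prod>(i, j)\<in>pairs l. ?d (Poly_Mapping.lookup R (i, j)))"
    by (intro prod.cong refl) (auto simp: lookup_add M0)
  finally show ?thesis
    using R by (simp add: R_infty_def case_prod_unfold lookup_add R0)
qed

text \<open>
  The action of \<open>R_infty\<close> cut off at exponent N, in 2m variables.
\<close>

definition box_star :: "nat \<Rightarrow> nat \<Rightarrow> nat \<Rightarrow> (nat \<Rightarrow> nat) \<Rightarrow> (nat \<Rightarrow> int) \<Rightarrow> xpoly fract" where
  "box_star m l N be al = (\<Sum>R\<in>monoms_in_box (pairs l) N.
     rat_scalar (R_infty l R) * eval_at m (star_monom l be al R))"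

lemma finite_monoms_in_box: "finite A \<Longrightarrow> finite (monoms_in_box A N)"
  unfolding monoms_in_box_def by (rule finite_bounded_monoms)

lemma eval_at_star_eq_box_star:
  obtains N where "N \<ge> N0" "eval_at m (star (R_infty l) l be al) = box_star m l N be al"
proof -
  define S where "S = {R. qconst (R_infty l R) * star_monom l be al R \<noteq> 0}"
  \<comment> \<open>Large enough to bound every exponent in the finitely many contributing monomials.\<close>
  define N where "N = N0 + (\<Sum>R\<in>S. \<Sum>x\<in>pairs l. Poly_Mapping.lookup R x)"
  have fin: "finite S" unfolding S_def by (rule finite_star_terms)
  have "S \<subseteq> monoms_in_box (pairs l) N"
  proof
    fix R assume R: "R \<in> S"
    have keys: "Poly_Mapping.keys R \<subseteq> pairs l"
      using R by (auto simp: S_def R_infty_def split: if_splits)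
    have "Poly_Mapping.lookup R x \<le> N" for x
    proof (cases "x \<in> pairs l")
      case True
      then have "Poly_Mapping.lookup R x \<le> (\<Sum>x\<in>pairs l. Poly_Mapping.lookup R x)"
        by (intro member_le_sum) auto
      also have "\<dots> \<le> (\<Sum>R\<in>S. \<Sum>x\<in>pairs l. Poly_Mapping.lookup R x)"
        using R fin by (intro member_le_sum) auto
      finally show ?thesis by (simp add: N_def)
    next
      case False
      then show ?thesis using keys by (metis in_keys_iff subsetD le0)
    qed
    then show "R \<in> monoms_in_box (pairs l) N"
      using keys by (simp add: monoms_in_box_def)
  qed
  then have "star (R_infty l) l be al =
      (\<Sum>R\<in>monoms_in_box (pairs l) N. qconst (R_infty l R) * star_monom l be al R)"
    unfolding star_def by (intro Sum_any.expand_superset) (auto simp: S_def finite_monoms_in_box)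
  then have "eval_at m (star (R_infty l) l be al) = box_star m l N be al"
    by (simp add: eval_at_sum box_star_def eval_at_qconst)
  then show thesis by (rule that[rotated]) (simp add: N_def)
qed

text \<open>
  The recursion of \<open>tuple_sum_Suc\<close>. The last position is outside the support exactly if M = 0, so
  only this term has the correction.
\<close>

lemma box_star_Suc:
  assumes le: "\<And>i. i \<in> {1..l} \<Longrightarrow> int (be i) \<le> al i"
  shows "box_star m (Suc l) N be al =
    (\<Sum>M\<in>monoms_in_box (last_column l) N.
       (\<Prod>i=1..l. ratio_series 1 $ Poly_Mapping.lookup M (i, Suc l)) *
       (nth_int (c_gen m (be (Suc l))) (al (Suc l) - (\<Sum>i=1..l. int (Poly_Mapping.lookup M (i, Suc l)))) +
         (if M = 0 then hat_correction (Suc l) (be (Suc l)) (al (Suc l)) else 0)) *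
       box_star m l N be (\<lambda>i. al i + int (Poly_Mapping.lookup M (i, Suc l))))"
proof -
  have disj: "pairs l \<inter> last_column l = {}" by (auto simp: pairs_def)
  show ?thesis
    unfolding box_star_def[of m "Suc l"] pairs_Suc sum_monoms_in_box_disjoint_Un[OF disj]
  proof (intro sum.cong refl)
    fix M assume "M \<in> monoms_in_box (last_column l) N"
    then have M: "Poly_Mapping.keys M \<subseteq> last_column l" by (simp add: monoms_in_box_def)
    let ?p = "al (Suc l) - (\<Sum>i=1..l. int (Poly_Mapping.lookup M (i, Suc l)))"
    let ?D = "\<Prod>i=1..l. ratio_series (1 :: xpoly fract) $ Poly_Mapping.lookup M (i, Suc l)"
    let ?c = "nth_int (c_gen m (be (Suc l))) ?p +
         (if M = 0 then hat_correction (Suc l) (be (Suc l)) (al (Suc l)) else 0)"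
    have c: "eval_at m (if M = 0 then c_hat (Suc l) (be (Suc l)) (al (Suc l)) else c_fun (be (Suc l)) ?p) = ?c"
      by (simp add: eval_at_c_fun eval_at_c_hat)
    show "(\<Sum>R\<in>monoms_in_box (pairs l) N.
        rat_scalar (R_infty (Suc l) (R + M)) * eval_at m (star_monom (Suc l) be al (R + M))) =
      ?D * ?c * box_star m l N be (\<lambda>i. al i + int (Poly_Mapping.lookup M (i, Suc l)))"
      unfolding box_star_def sum_distrib_left
    proof (intro sum.cong refl)
      fix R assume "R \<in> monoms_in_box (pairs l) N"
      then have R: "Poly_Mapping.keys R \<subseteq> pairs l" by (simp add: monoms_in_box_def)
      have monom: "star_monom (Suc l) be al (R + M) =
          star_monom l be (\<lambda>i. al i + int (Poly_Mapping.lookup M (i, Suc l))) R *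
          (if M = 0 then c_hat (Suc l) (be (Suc l)) (al (Suc l)) else c_fun (be (Suc l)) ?p)"
        using R M le by (rule star_monom_last_column)
      show "rat_scalar (R_infty (Suc l) (R + M)) * eval_at m (star_monom (Suc l) be al (R + M)) =
        ?D * ?c * (rat_scalar (R_infty l R) *
          eval_at m (star_monom l be (\<lambda>i. al i + int (Poly_Mapping.lookup M (i, Suc l))) R))"
        unfolding R_infty_last_column[OF R M] monom eval_at_hom(5) c
          rat_scalar_hom(5) rat_scalar_prod rat_scalar_ratio
        by (simp only: mult_ac)
    qed
  qed
qed

section \<open>Comparison of the two recursions\<close>

lemma xfrac_distinct: "inj_on xfrac A"
proof (rule inj_onI)
  fix i j assume "xfrac i = xfrac j"
  then have "(indet i :: xpoly) = indet j" by (simp add: xfrac_def to_fract_inject)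
  then have "Poly_Mapping.lookup (indet i :: xpoly) (Poly_Mapping.single i 1) =
      Poly_Mapping.lookup (indet j) (Poly_Mapping.single i 1)" by simp
  then have "Poly_Mapping.single i (1::nat) = Poly_Mapping.single j 1"
    by (auto simp: indet_def lookup_single when_def split: if_splits)
  then have "Poly_Mapping.lookup (Poly_Mapping.single i (1::nat)) j = 1"
    by simp
  then show "i = j" by (simp add: lookup_single when_def split: if_splits)
qed

lemma xfrac_add_nonzero: "xfrac i + xfrac j \<noteq> 0"
proof
  assume "xfrac i + xfrac j = 0"
  then have "to_fract (indet i + indet j :: xpoly) = to_fract 0"
    by (simp add: xfrac_def Zero_fract_def)
  then have "(indet i + indet j :: xpoly) = 0" by (simp only: to_fract_inject)
  then have "Poly_Mapping.lookup (indet i + indet j :: xpoly) (Poly_Mapping.single i 1) = 0" by simp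
  then show False
    by (auto simp: indet_def lookup_add lookup_single when_def split: if_splits)
qed

text \<open>
  The bound on the sum of the subscripts guarantees that the cut-off is harmless throughout the
  induction: raising by M moves units from the last subscript to the others, and unless this makes
  the last subscript negative, which kills the last factor, the other subscripts add up to at most
  the former total.
\<close>

lemma box_star_eq_tuple_sum:
  assumes "\<And>i. i \<in> {1..l} \<Longrightarrow> 0 < be i" "\<And>i. i \<in> {1..l} \<Longrightarrow> be i \<le> a i"
    and "(\<Sum>i=1..l. a i) \<le> N"
  shows "box_star m l N be (\<lambda>i. int (a i)) = tuple_sum xfrac tfrac {1..2 * m} l be a"
  using assms
proof (induction l arbitrary: a)
  case 0
  show ?case
    by (simp add: box_star_def tuple_sum_def tuple_term_def R_infty_def star_monom_def rat_scalar_hom)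
next
  case (Suc l)
  let ?b = "be (Suc l)" and ?p = "a (Suc l)"
  let ?D = "\<lambda>M. \<Prod>i=1..l. ratio_series (1 :: xpoly fract) $ Poly_Mapping.lookup M (i, Suc l)"
  let ?s = "\<lambda>M. \<Sum>i=1..l. int (Poly_Mapping.lookup M (i, Suc l))"
  let ?Z = "tuple_sum xfrac tfrac {1..2 * m} l be"
  let ?h = "hat_correction (Suc l) ?b (int ?p)"
  let ?B = "monoms_in_box (last_column l) N"
  have step: "?D M * (nth_int (c_gen m ?b) (int ?p - ?s M) + (if M = 0 then ?h else 0)) *
        box_star m l N be (\<lambda>i. int (a i) + int (Poly_Mapping.lookup M (i, Suc l))) =
      ?D M * nth_int (c_gen m ?b) (int ?p - ?s M) * ?Z (\<lambda>i. a i + Poly_Mapping.lookup M (i, Suc l)) +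
      (if M = 0 then ?h * ?Z a else 0)" if "M \<in> ?B" for M
  proof (cases "?s M \<le> int ?p")
    case True
    have "int (\<Sum>i=1..l. a i + Poly_Mapping.lookup M (i, Suc l)) = int (\<Sum>i=1..l. a i) + ?s M"
      by (simp add: sum.distrib)
    also have "\<dots> \<le> int N" using True Suc.prems(3) by (simp flip: of_nat_sum)
    finally have "(\<Sum>i=1..l. a i + Poly_Mapping.lookup M (i, Suc l)) \<le> N"
      by (simp only: of_nat_le_iff)
    then have "box_star m l N be (\<lambda>i. int (a i + Poly_Mapping.lookup M (i, Suc l))) =
        ?Z (\<lambda>i. a i + Poly_Mapping.lookup M (i, Suc l))"
      using Suc.prems by (intro Suc.IH) (auto intro: trans_le_add1)
    then show ?thesis
      by (simp add: distrib_left distrib_right ratio_series_nth)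
  next
    case False
    \<comment> \<open>Here the induction hypothesis is not available, but the last factor vanishes.\<close>
    then have "M \<noteq> 0" by auto
    then show ?thesis using False by (simp add: nth_int_def)
  qed
  have "box_star m (Suc l) N be (\<lambda>i. int (a i)) = (\<Sum>M\<in>?B.
      ?D M * nth_int (c_gen m ?b) (int ?p - ?s M) * ?Z (\<lambda>i. a i + Poly_Mapping.lookup M (i, Suc l)) +
      (if M = 0 then ?h * ?Z a else 0))"
  proof -
    have le: "int (be i) \<le> int (a i)" if "i \<in> {1..l}" for i
      using Suc.prems(2)[of i] that by auto
    show ?thesis
      by (rule trans[OF box_star_Suc[OF le] sum.cong[OF refl step]])
  qed
  also have "\<dots> = (\<Sum>M\<in>?B. ?D M * nth_int (c_gen m ?b) (int ?p - ?s M) *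
      ?Z (\<lambda>i. a i + Poly_Mapping.lookup M (i, Suc l))) + ?h * ?Z a"
  proof -
    have "0 \<in> ?B" by (simp add: monoms_in_box_def)
    then show ?thesis
      unfolding sum.distrib by (simp add: sum.delta' finite_monoms_in_box)
  qed
  also have "?h = (if ?p = ?b then (- 1) ^ Suc l * elem_sym ?b ?b (\<lambda>i. - tfrac i) else 0)"
    using Suc.prems(1)[of "Suc l"] by (auto simp: hat_correction_def)
  also have "(\<Sum>M\<in>?B. ?D M * nth_int (c_gen m ?b) (int ?p - ?s M) *
      ?Z (\<lambda>i. a i + Poly_Mapping.lookup M (i, Suc l))) + \<dots> * ?Z a =
      tuple_sum xfrac tfrac {1..2 * m} (Suc l) be a"
    using Suc.prems
    by (intro tuple_sum_Suc[symmetric] xfrac_distinct xfrac_add_nonzero) auto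
  finally show ?case .
qed

text \<open>
  Later members of the family determine the earlier ones by restriction, so finitely many members
  may be ignored.
\<close>

lemma xlim_eqI:
  assumes "\<And>m. k \<le> 2 * m \<Longrightarrow> component F m = component G m"
  shows "F = G"
proof -
  have "component F m = component G m" for m
  proof -
    have "restr (2 * m) (component H (m + k)) = component H m" for H
      using component[of H] by auto
    then show ?thesis using assms[of "m + k"] by (metis le_add2 mult_2 trans_le_add1)
  qed
  then show ?thesis by (metis component_inject ext)
qed

text \<open>
  The raising operator expression is an element of the projective limit whose members agree with
  Ivanov's formula wherever the latter is defined. So it is the unique such element, which also
  shows that Ivanov's rational functions in an even number of variables are polynomials.
\<close>

theorem proposition4p4:
  fixes lam :: "nat list"
  assumes "strict_partition lam"
  shows "double_schur_P lam =
    qconst (1 / 2 ^ length lam) *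
    star (R_infty (length lam)) (length lam) (part lam) (\<lambda>i. int (part lam i))"
proof -
  define l where "l = length lam"
  define F where "F = qconst (1 / 2 ^ l) * star (R_infty l) l (part lam) (\<lambda>i. int (part lam i))"
  have pos: "0 < part lam i" if "i \<in> {1..l}" for i
  proof -
    have "part lam i \<in> set lam" using that by (auto simp: part_def l_def)
    then show ?thesis using assms by (metis strict_partition_def gr0I)
  qed
  have F: "to_fract (component F m) = double_schur_P_fin lam (2 * m)" if "l \<le> 2 * m" for m
  proof -
    let ?Z = "tuple_sum xfrac tfrac {1..2 * m} l (part lam) (part lam)"
    obtain N where large: "(\<Sum>i=1..l. part lam i) \<le> N" and
      N: "eval_at m (star (R_infty l) l (part lam) (\<lambda>i. int (part lam i))) =
        box_star m l N (part lam) (\<lambda>i. int (part lam i))"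
      by (rule eval_at_star_eq_box_star)
    have star: "eval_at m (star (R_infty l) l (part lam) (\<lambda>i. int (part lam i))) = ?Z"
      unfolding N using pos large by (intro box_star_eq_tuple_sum) auto
    have two: "rat_scalar (1 / 2 ^ l) * 2 ^ l = 1"
    proof -
      have "rat_scalar 2 = 2" using rat_scalar_hom(3)[of 1 1] by (simp add: rat_scalar_hom)
      then have "rat_scalar (1 / 2 ^ l) * 2 ^ l = rat_scalar (1 / 2 ^ l * 2 ^ l)"
        by (simp only: rat_scalar_hom rat_scalar_power)
      then show ?thesis by (simp add: rat_scalar_hom)
    qed
    have fact: "(of_nat (fact (2 * m - l)) :: xpoly fract) \<noteq> 0"
    proof
      assume "(of_nat (fact (2 * m - l)) :: xpoly fract) = 0"
      then have "to_fract (of_nat (fact (2 * m - l)) :: xpoly) = to_fract 0"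
        unfolding of_nat_fract Zero_fract_def .
      then have "(of_nat (fact (2 * m - l)) :: xpoly) = 0" by (simp only: to_fract_inject)
      then show False by simp
    qed
    have "2 ^ l * double_schur_P_fin lam (2 * m) = ?Z"
      using ivanov_sum_eq_tuple_sum[OF that xfrac_distinct xfrac_add_nonzero, of tfrac "part lam"] fact
      unfolding double_schur_P_fin_def l_def[symmetric] by (simp add: field_simps)
    then have "eval_at m F = rat_scalar (1 / 2 ^ l) * (2 ^ l * double_schur_P_fin lam (2 * m))"
      by (simp add: F_def star eval_at_qconst)
    also have "\<dots> = double_schur_P_fin lam (2 * m)"
      using two by (simp add: mult.assoc[symmetric])
    finally show ?thesis by (simp add: eval_at_def)
  qed
  have "double_schur_P lam = F"
    unfolding double_schur_P_def l_def[symmetric]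
  proof (rule the_equality)
    show "\<forall>m. l \<le> 2 * m \<longrightarrow> to_fract (component F m) = double_schur_P_fin lam (2 * m)"
      using F by blast
    fix G assume "\<forall>m. l \<le> 2 * m \<longrightarrow> to_fract (component G m) = double_schur_P_fin lam (2 * m)"
    then have "component G m = component F m" if "l \<le> 2 * m" for m
      using F that by (metis to_fract_inject)
    then show "G = F" by (rule xlim_eqI)
  qed
  then show ?thesis by (simp add: F_def l_def)
qed

end
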